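(* Let $d\ge1$, $p\in\mathbb N=\{0,1,2,\dots\}$, let $T\subset\mathbb R^d$ be a mesh element (an open, bounded, connected, Lipschitz polytope) and $\mathbf x_T\in T$. Let $\mathcal Lv=\mathrm{div}(-\boldsymbol K\nabla v+\boldsymbol\beta v)+\sigma v$ with $\boldsymbol K_{jm},\boldsymbol\beta_j\in C^{\max\{p-1,1\}}(T)$ for all $j,m=1,\dots,d$, $\sigma\in C^{\max\{p-2,0\}}(T)$, and suppose there is $k_{min}>0$ such that $\boldsymbol\xi^T\boldsymbol K(\mathbf x)\boldsymbol\xi\ge k_{min}|\boldsymbol\xi|^2$ for all $\boldsymbol\xi\in\mathbb R^d$ and $\mathbf x\in T$. Then the conditions $D^{\boldsymbol i}(\mathcal Lv)(\mathbf x_T)=0$, $|\boldsymbol i|\le p-2$, in the definition of $\mathbb{QT}^p(T)$ are linearly independent: $$\dim\big(\mathbb P^p_d(T)\big)-\#\{\boldsymbol i\in\mathbb N^d\mid|\boldsymbol i|\le p-2\}=\binom{p+d}{d}-\binom{p+d-2}{d}=N_{d,p}=\dim\big(\mathbb{QT}^p(T)\big),$$ where $$N_{d,p}=\binom{p+d-1}{d-1}+\binom{p+d-2}{d-1}=\frac{(p+d-2)!\,(2p+d-1)}{(d-1)!\,p!}.$$ In particular, $\dim(\mathbb{QT}^p(T))$ equals $2$ for $d=1$, $2p+1$ for $d=2$, $(p+1)^2$ for $d=3$, and $\dim(\mathbb{QT}^p(T))=\mathcal O(p^{d-1})$ as $p\to\infty$, whereas $\dim(\mathbb P^p_d(T))=\binom{p+d}{d}=\mathcal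 O(p^{d})$.
   Context: $\mathbb P^p_d(T)$ is the space of polynomials of total degree at most $p$ in $d$ variables on $T$. The local quasi-Trefftz space is $$\mathbb{QT}^p(T)=\{v\in\mathbb P^p_d(T)\mid D^{\boldsymbol i}(\mathcal Lv)(\mathbf x_T)=0\ \ \forall\boldsymbol i\in\mathbb N^d,\ |\boldsymbol i|\le p-2\}.$$ Convention: $\binom nk=0$ if $0\le n<k$.
   Formalization: For d=1, p=0 the space QT^0(T) has dimension 1, not 2, and the factorial formula contains (-1)!; so "equals 2 for d=1" is stated for p≥1, the factorial formula for p+d≥2, and binomials with negative upper entry are taken to be 0. *)

theory Defs
  imports
    "HOL-Analysis.Analysis"
    "HOL-Library.Function_Algebras"
    "HOL-Library.Landau_Symbols"
begin

subsection \<open>The real vector space of scalar functions\<close>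

text \<open>Function types carry no instance of the class of real vector spaces, so the scalar
  multiplication is given explicitly.\<close>

interpretation fun_space: vector_space "\<lambda>(c::real) (f :: 'a \<Rightarrow> real) x. c * f x"
  by unfold_locales (auto simp: fun_eq_iff algebra_simps)

subsection \<open>Partial derivatives and classes of differentiability\<close>

definition partial :: "'n::finite \<Rightarrow> (real^'n \<Rightarrow> real) \<Rightarrow> real^'n \<Rightarrow> real" where
  "partial j f x = deriv (\<lambda>t. f (x + t *\<^sub>R axis j 1)) 0"

definition has_partial :: "'n::finite \<Rightarrow> (real^'n \<Rightarrow> real) \<Rightarrow> real^'n \<Rightarrow> bool" where
  "has_partial j f x \<longleftrightarrow> (\<lambda>t. f (x + t *\<^sub>R axis j 1)) field_differentiable (at 0)"

text \<open>\<open>C_on k S f\<close>: all partial derivatives of \<open>f\<close> of order at most \<open>k\<close>, in every order of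
  differentiation, exist and are continuous on \<open>S\<close>.  It is meant for open \<open>S\<close>.\<close>

fun C_on :: "nat \<Rightarrow> (real^'n::finite) set \<Rightarrow> (real^'n \<Rightarrow> real) \<Rightarrow> bool" where
  "C_on 0 S f \<longleftrightarrow> continuous_on S f"
| "C_on (Suc k) S f \<longleftrightarrow> continuous_on S f \<and>
     (\<forall>j. (\<forall>x\<in>S. has_partial j f x) \<and> C_on k S (partial j f))"

text \<open>A multi-index in \<open>\<nat>\<^sup>d\<close> is a function \<open>'n \<Rightarrow> nat\<close>.\<close>

definition mi_len :: "('n::finite \<Rightarrow> nat) \<Rightarrow> nat" where
  "mi_len i = (\<Sum>j\<in>UNIV. i j)"

text \<open>An index type carries no order, so \<open>mi_deriv\<close> differentiates along an arbitrary fixed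
  enumeration of the coordinates.  By Schwarz's theorem the choice is immaterial
  for functions of class \<open>C\<^sup>k\<close> with \<open>k = |i|\<close>.\<close>

definition coords :: "'n::finite list" where
  "coords = (SOME js. distinct js \<and> set js = UNIV)"

definition mi_deriv :: "('n::finite \<Rightarrow> nat) \<Rightarrow> (real^'n \<Rightarrow> real) \<Rightarrow> real^'n \<Rightarrow> real" where
  "mi_deriv i f = foldr (\<lambda>j g. (partial j ^^ i j) g) coords f"

definition grad :: "(real^'n::finite \<Rightarrow> real) \<Rightarrow> real^'n \<Rightarrow> real^'n" where
  "grad v x = (\<chi> j. partial j v x)"

definition dvg :: "(real^'n::finite \<Rightarrow> real^'n) \<Rightarrow> real^'n \<Rightarrow> real" where
  "dvg F x = (\<Sum>j\<in>UNIV. partial j (\<lambda>y. F y $ j) x)"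

subsection \<open>Mesh elements\<close>

text \<open>Near each boundary point \<open>S\<close> is the strict epigraph, in some unit direction \<open>e\<close>, of a
  Lipschitz function on the hyperplane orthogonal to \<open>e\<close>.\<close>

definition lipschitz_domain :: "(real^'n::finite) set \<Rightarrow> bool" where
  "lipschitz_domain S \<longleftrightarrow>
     (\<forall>x\<in>frontier S. \<exists>r>0. \<exists>e \<phi> L. norm e = 1 \<and> L-lipschitz_on {y. e \<bullet> y = 0} \<phi> \<and>
        S \<inter> ball x r = {y \<in> ball x r. \<phi> (y - (e \<bullet> y) *\<^sub>R e) < e \<bullet> y})"

text \<open>Elements need not be convex, whereas the library's \<open>polytope\<close> is a compact convex
  polytope; a general polytope is a finite union of these.\<close>

definition mesh_element :: "(real^'n::finite) set \<Rightarrow> bool" where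
  "mesh_element T \<longleftrightarrow> open T \<and> bounded T \<and> connected T \<and> lipschitz_domain T \<and>
     (\<exists>\<P>. finite \<P> \<and> (\<forall>Q\<in>\<P>. polytope Q) \<and> closure T = \<Union>\<P>)"

subsection \<open>The differential operator and the quasi-Trefftz space\<close>

definition diff_op :: "(real^'n::finite \<Rightarrow> real^'n^'n) \<Rightarrow> (real^'n \<Rightarrow> real^'n) \<Rightarrow> (real^'n \<Rightarrow> real) \<Rightarrow>
    (real^'n \<Rightarrow> real) \<Rightarrow> real^'n \<Rightarrow> real" where
  "diff_op K \<beta> \<sigma> v x = dvg (\<lambda>y. - (K y *v grad v y) + v y *\<^sub>R \<beta> y) x + \<sigma> x * v x"

text \<open>A function on \<open>T\<close> is represented by its extension by \<open>0\<close>, so that equality of functions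
  is equality on \<open>T\<close>.\<close>

definition poly_space :: "nat \<Rightarrow> (real^'n::finite) set \<Rightarrow> (real^'n \<Rightarrow> real) set" where
  "poly_space p T =
     {v. \<exists>c. v = (\<lambda>x. if x \<in> T
                     then \<Sum>i\<in>{i. mi_len i \<le> p}. c i * (\<Prod>j\<in>UNIV. (x $ j) ^ i j) else 0)}"

text \<open>The bound \<open>p - 2\<close> is an integer: for \<open>p < 2\<close> there are no multi-indices.\<close>

definition qt_indices :: "nat \<Rightarrow> ('n::finite \<Rightarrow> nat) set" where
  "qt_indices p = {i. int (mi_len i) \<le> int p - 2}"

definition QT :: "nat \<Rightarrow> (real^'n::finite) set \<Rightarrow> real^'n \<Rightarrow> (real^'n \<Rightarrow> real^'n^'n) \<Rightarrow>
    (real^'n \<Rightarrow> real^'n) \<Rightarrow> (real^'n \<Rightarrow> real) \<Rightarrow> (real^'n \<Rightarrow> real) set" where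
  "QT p T xT K \<beta> \<sigma> =
     {v \<in> poly_space p T. \<forall>i\<in>qt_indices p. mi_deriv i (diff_op K \<beta> \<sigma> v) xT = 0}"

definition qt_setting :: "nat \<Rightarrow> (real^'n::finite) set \<Rightarrow> real^'n \<Rightarrow> (real^'n \<Rightarrow> real^'n^'n) \<Rightarrow>
    (real^'n \<Rightarrow> real^'n) \<Rightarrow> (real^'n \<Rightarrow> real) \<Rightarrow> bool" where
  "qt_setting p T xT K \<beta> \<sigma> \<longleftrightarrow>
     mesh_element T \<and> xT \<in> T \<and>
     (\<forall>j m. C_on (max (p - 1) 1) T (\<lambda>x. K x $ j $ m)) \<and>
     (\<forall>j. C_on (max (p - 1) 1) T (\<lambda>x. \<beta> x $ j)) \<and>
     C_on (max (p - 2) 0) T \<sigma> \<and>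
     (\<exists>k_min>0. \<forall>x\<in>T. \<forall>\<xi>. \<xi> \<bullet> (K x *v \<xi>) \<ge> k_min * (norm \<xi>)\<^sup>2)"

text \<open>A family of functionals on \<open>V\<close>, indexed by the finite set \<open>I\<close>, is linearly independent.\<close>

definition lin_indep_functionals ::
  "('a \<Rightarrow> real) set \<Rightarrow> 'i set \<Rightarrow> ('i \<Rightarrow> ('a \<Rightarrow> real) \<Rightarrow> real) \<Rightarrow> bool" where
  "lin_indep_functionals V I \<Lambda> \<longleftrightarrow>
     (\<forall>c. (\<forall>v\<in>V. (\<Sum>i\<in>I. c i * \<Lambda> i v) = 0) \<longrightarrow> (\<forall>i\<in>I. c i = 0))"

subsection \<open>The dimension formula\<close>

text \<open>For \<open>d = 1\<close>, \<open>p = 0\<close> the upper entry \<open>p + d - 2\<close> equals \<open>-1\<close>; the convention that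
  the coefficient vanishes when the lower entry exceeds the upper one is extended to vanishing
  for every negative upper entry.\<close>

definition binom :: "int \<Rightarrow> nat \<Rightarrow> int" where
  "binom n k = (if n < 0 then 0 else int (nat n choose k))"

definition N_dim :: "nat \<Rightarrow> nat \<Rightarrow> int" where
  "N_dim d p = binom (int p + int d - 1) (d - 1) + binom (int p + int d - 2) (d - 1)"

end

theory Submission
  imports Defs
begin

text \<open>In non-divergence form the operator is \<open>-\<Sum>\<^sub>j\<^sub>k K\<^sub>j\<^sub>k \<partial>\<^sub>j\<partial>\<^sub>k v\<close> plus terms of lower order.  Test the
  conditions at \<open>t = x\<^sub>T\<close> on the monomials \<open>(x - t)\<^sup>m\<close> with \<open>m = i + 2 e\<^sub>a\<close>, for a fixed direction \<open>a\<close>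
  and \<open>|i| \<le> p - 2\<close>.  A derivative of order \<open>|i'| \<le> |i|\<close> of the image at \<open>t\<close> sees only the second-order
  part, frozen at \<open>t\<close>, and is nonzero only if \<open>i' + e\<^sub>j + e\<^sub>k = m\<close> for some \<open>j, k\<close>.  The matrix of the
  conditions is therefore triangular for the lexicographic order of \<open>(|i|, i\<^sub>a)\<close>, with diagonal
  entries \<open>-K\<^sub>a\<^sub>a(t) m!\<close>, nonzero by ellipticity.  So the conditions are linearly independent and
  the dimension of their common kernel follows by counting multi-indices.\<close>

subsection \<open>Calculus of partial derivatives\<close>

lemma has_partial_iff:
  "has_partial j f x \<longleftrightarrow>
    ((\<lambda>t. f (x + t *\<^sub>R axis j 1)) has_field_derivative partial j f x) (at 0)"
  by (simp add: has_partial_def partial_def DERIV_deriv_iff_field_differentiable)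

lemma partialI:
  assumes "((\<lambda>t. f (x + t *\<^sub>R axis j 1)) has_field_derivative D) (at 0)"
  shows "has_partial j f x" "partial j f x = D"
  using assms by (auto simp: has_partial_def partial_def DERIV_imp_deriv field_differentiable_def)

lemma eventually_line_in_open:
  fixes x e :: "'a::real_normed_vector"
  assumes "open T" "x \<in> T"
  shows "eventually (\<lambda>t. x + t *\<^sub>R e \<in> T) (nhds 0)"
proof -
  have "open ((\<lambda>t. x + t *\<^sub>R e) -` T)"
    by (intro open_vimage assms continuous_intros)
  then show ?thesis
    using assms by (auto dest: eventually_nhds_in_open[of _ 0])
qed

text \<open>Since \<open>T\<close> is open, a short segment through \<open>x\<close> stays in
  \<open>T\<close>, so values off \<open>T\<close> are invisible. This lets functions extended by 0
  be traded for smooth ones.\<close>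

lemma partial_cong:
  assumes "open T" "x \<in> T" "\<And>y. y \<in> T \<Longrightarrow> f y = g y"
  shows "has_partial j f x \<longleftrightarrow> has_partial j g x" "partial j f x = partial j g x"
proof -
  have ev: "eventually (\<lambda>t. f (x + t *\<^sub>R axis j 1) = g (x + t *\<^sub>R axis j 1)) (nhds 0)"
    using eventually_line_in_open[OF assms(1,2)] by (rule eventually_mono) (use assms(3) in auto)
  show "partial j f x = partial j g x"
    unfolding partial_def by (rule deriv_cong_ev[OF ev refl])
  then show "has_partial j f x \<longleftrightarrow> has_partial j g x"
    unfolding has_partial_iff using DERIV_cong_ev[OF refl ev] by simp
qed

lemma partial_add:
  assumes "has_partial j f x" "has_partial j g x"
  shows "has_partial j (\<lambda>y. f y + g y) x"
    "partial j (\<lambda>y. f y + g y) x = partial j f x + partial j g x"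
  by (rule partialI; rule DERIV_add; use assms in \<open>simp add: has_partial_iff\<close>)+

lemma partial_mult:
  assumes "has_partial j f x" "has_partial j g x"
  shows "has_partial j (\<lambda>y. f y * g y) x"
    "partial j (\<lambda>y. f y * g y) x = partial j f x * g x + f x * partial j g x"
proof -
  have "((\<lambda>t. f (x + t *\<^sub>R axis j 1) * g (x + t *\<^sub>R axis j 1)) has_field_derivative
      partial j f x * g x + f x * partial j g x) (at 0)"
    using assms unfolding has_partial_iff by (auto intro!: derivative_eq_intros)
  from partialI[OF this] show "has_partial j (\<lambda>y. f y * g y) x"
    "partial j (\<lambda>y. f y * g y) x = partial j f x * g x + f x * partial j g x" by auto
qed

lemma partial_const: "has_partial j (\<lambda>y. c) x" "partial j (\<lambda>y. c) x = 0"
  using partialI[of "\<lambda>y. c" x j 0] by simp_all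

lemma partial_cmult:
  assumes "has_partial j f x"
  shows "has_partial j (\<lambda>y. c * f y) x" "partial j (\<lambda>y. c * f y) x = c * partial j f x"
  using partial_mult[OF partial_const(1)[of j c] assms] by (simp_all add: partial_const)

lemma partial_sum:
  assumes "finite I" "\<And>i. i \<in> I \<Longrightarrow> has_partial j (f i) x"
  shows "has_partial j (\<lambda>y. \<Sum>i\<in>I. f i y) x"
    "partial j (\<lambda>y. \<Sum>i\<in>I. f i y) x = (\<Sum>i\<in>I. partial j (f i) x)"
proof -
  have "has_partial j (\<lambda>y. \<Sum>i\<in>I. f i y) x \<and>
      partial j (\<lambda>y. \<Sum>i\<in>I. f i y) x = (\<Sum>i\<in>I. partial j (f i) x)"
    using assms by (induction I rule: finite_induct) (auto simp: partial_const partial_add)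
  then show "has_partial j (\<lambda>y. \<Sum>i\<in>I. f i y) x"
    "partial j (\<lambda>y. \<Sum>i\<in>I. f i y) x = (\<Sum>i\<in>I. partial j (f i) x)" by auto
qed

section \<open>Closure properties of the classes \<open>C_on k T\<close>\<close>

lemma C_on_cong:
  assumes "open T" "\<And>y. y \<in> T \<Longrightarrow> f y = g y"
  shows "C_on k T f \<longleftrightarrow> C_on k T g"
  using assms(2)
proof (induction k arbitrary: f g)
  case 0
  then show ?case by (simp cong: continuous_on_cong)
next
  case (Suc k)
  note p = partial_cong[OF assms(1) _ Suc.prems]
  have "C_on k T (partial j f) = C_on k T (partial j g)" for j
    using p(2) by (rule Suc.IH)
  then show ?case
    using p(1) Suc.prems by (simp cong: continuous_on_cong)
qed

lemma C_on_Suc_imp: "C_on (Suc k) T f \<Longrightarrow> C_on k T f"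
proof (induction k arbitrary: f)
  case (Suc k)
  then show ?case using C_on.simps(2)[of k] C_on.simps(2)[of "Suc k"] by blast
qed simp

lemma C_on_mono:
  assumes "l \<le> k" "C_on k T f"
  shows "C_on l T f"
  using assms by (induction rule: dec_induct) (blast dest: C_on_Suc_imp)+

lemma C_on_const: "C_on k T (\<lambda>x. c)"
proof (induction k arbitrary: c)
  case (Suc k)
  have "partial j (\<lambda>x. c) = (\<lambda>x. 0)" for j :: 'a
    by (simp add: fun_eq_iff partial_const)
  then show ?case using Suc by (simp add: partial_const)
qed simp

text \<open>The sum rule for derivatives is available on \<open>T\<close> only, so the derivative is
  rewritten there and its class transferred by \<open>C_on_cong\<close>. Products are treated in the
  same way.\<close>

lemma C_on_add:
  assumes "open T" "C_on k T f" "C_on k T g"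
  shows "C_on k T (\<lambda>x. f x + g x)"
  using assms(2,3)
proof (induction k arbitrary: f g)
  case (Suc k)
  have "C_on k T (partial j (\<lambda>x. f x + g x))" for j
  proof -
    have "C_on k T (\<lambda>x. partial j f x + partial j g x)"
      using Suc by auto
    then show ?thesis
      by (rule C_on_cong[OF assms(1), THEN iffD1, rotated]) (use Suc.prems in \<open>auto simp: partial_add\<close>)
  qed
  then show ?case
    using Suc.prems by (auto intro: continuous_on_add partial_add)
qed (auto intro: continuous_on_add)

lemma C_on_mult:
  assumes "open T" "C_on k T f" "C_on k T g"
  shows "C_on k T (\<lambda>x. f x * g x)"
  using assms(2,3)
proof (induction k arbitrary: f g)
  case (Suc k)
  have "C_on k T (partial j (\<lambda>x. f x * g x))" for j
  proof -
    have "C_on k T (\<lambda>x. partial j f x * g x + f x * partial j g x)"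
      using Suc.prems by (intro C_on_add assms Suc.IH) (auto intro: C_on_Suc_imp)
    then show ?thesis
      by (rule C_on_cong[OF assms(1), THEN iffD1, rotated]) (use Suc.prems in \<open>auto simp: partial_mult\<close>)
  qed
  then show ?case
    using Suc.prems by (auto intro: continuous_on_mult partial_mult)
qed (auto intro: continuous_on_mult)

lemma C_on_cmult: "open T \<Longrightarrow> C_on k T f \<Longrightarrow> C_on k T (\<lambda>x. c * f x)"
  by (rule C_on_mult[OF _ C_on_const])

lemma C_on_sum:
  assumes "open T" "finite I" "\<And>i. i \<in> I \<Longrightarrow> C_on k T (f i)"
  shows "C_on k T (\<lambda>x. \<Sum>i\<in>I. f i x)"
  using assms(2,3)
  by (induction I rule: finite_induct) (auto simp: C_on_const intro!: C_on_add[OF assms(1)])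

subsection \<open>Iterated partial derivatives\<close>

text \<open>The last entry of the list acts first. Inductions therefore remove entries from the end:
  the function is replaced by a derivative and the outer differentiations stay as they are.\<close>

definition partials :: "'n::finite list \<Rightarrow> (real^'n \<Rightarrow> real) \<Rightarrow> real^'n \<Rightarrow> real" where
  "partials js f = foldr partial js f"

lemma partials_Nil [simp]: "partials [] f = f"
  and partials_snoc [simp]: "partials (js @ [j]) f = partials js (partial j f)"
  by (simp_all add: partials_def)

lemma partials_cong:
  assumes "open T" "\<And>y. y \<in> T \<Longrightarrow> f y = g y" "x \<in> T"
  shows "partials js f x = partials js g x"
  using assms(2,3)
proof (induction js arbitrary: f g x rule: rev_induct)
  case (snoc j js)
  have "partials js (partial j f) x = partials js (partial j g) x"
    by (intro snoc.IH partial_cong(2)[OF assms(1)] snoc.prems)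
  then show ?case by simp
qed simp

lemma partials_zero: "partials js (\<lambda>x. 0) x = 0"
proof (induction js rule: rev_induct)
  case (snoc j js)
  have "partial j (\<lambda>x. 0) = (\<lambda>x. 0)" by (simp add: fun_eq_iff partial_const)
  then show ?case using snoc by simp
qed simp

lemma partials_add:
  assumes "open T" "C_on (length js) T f" "C_on (length js) T g" "x \<in> T"
  shows "partials js (\<lambda>x. f x + g x) x = partials js f x + partials js g x"
  using assms(2-)
proof (induction js arbitrary: f g x rule: rev_induct)
  case (snoc j js)
  have "partials js (partial j (\<lambda>x. f x + g x)) x
      = partials js (\<lambda>x. partial j f x + partial j g x) x"
    by (rule partials_cong[OF assms(1)]) (use snoc.prems in \<open>auto simp: partial_add\<close>)
  also have "\<dots> = partials js (partial j f) x + partials js (partial j g) x"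
    using snoc.prems by (intro snoc.IH) auto
  finally show ?case by simp
qed simp

lemma partials_cmult:
  assumes "open T" "C_on (length js) T f" "x \<in> T"
  shows "partials js (\<lambda>x. c * f x) x = c * partials js f x"
  using assms(2-)
proof (induction js arbitrary: f x rule: rev_induct)
  case (snoc j js)
  have "partials js (partial j (\<lambda>x. c * f x)) x = partials js (\<lambda>x. c * partial j f x) x"
    by (rule partials_cong[OF assms(1)]) (use snoc.prems in \<open>auto simp: partial_cmult\<close>)
  also have "\<dots> = c * partials js (partial j f) x"
    using snoc.prems by (intro snoc.IH) auto
  finally show ?case by simp
qed simp

lemma partials_sum:
  assumes "open T" "finite I" "\<And>i. i \<in> I \<Longrightarrow> C_on (length js) T (f i)" "x \<in> T"
  shows "partials js (\<lambda>x. \<Sum>i\<in>I. f i x) x = (\<Sum>i\<in>I. partials js (f i) x)"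
  using assms(2,3)
proof (induction I rule: finite_induct)
  case (insert i I)
  have "partials js (\<lambda>x. f i x + (\<Sum>i\<in>I. f i x)) x
      = partials js (f i) x + partials js (\<lambda>x. \<Sum>i\<in>I. f i x) x"
    using insert by (intro partials_add[OF assms(1) _ _ assms(4)] C_on_sum[OF assms(1)]) auto
  with insert show ?case by simp
qed (simp add: partials_zero)

section \<open>Multi-index derivatives as derivatives along lists\<close>

definition mi_list :: "('n::finite \<Rightarrow> nat) \<Rightarrow> 'n list" where
  "mi_list i = concat (map (\<lambda>j. replicate (i j) j) coords)"

lemma coords: "distinct (coords :: 'n::finite list)" "set (coords :: 'n list) = UNIV"
proof -
  have "\<exists>js :: 'n list. distinct js \<and> set js = UNIV"
    using finite_distinct_list[OF finite, of "UNIV :: 'n set"] by blast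
  then have "distinct (coords :: 'n list) \<and> set (coords :: 'n list) = UNIV"
    unfolding coords_def by (rule someI_ex)
  then show "distinct (coords :: 'n list)" "set (coords :: 'n list) = UNIV" by auto
qed

lemma mi_deriv_eq_partials: "mi_deriv i f = partials (mi_list i) f"
proof -
  have "foldr partial (replicate n j) g = (partial j ^^ n) g" for n and j :: 'a and g
    by (induction n) auto
  then have "foldr (\<lambda>j g. (partial j ^^ i j) g) js f
      = foldr partial (concat (map (\<lambda>j. replicate (i j) j) js)) f" for js :: "'a list"
    by (induction js) auto
  then show ?thesis
    by (simp add: mi_deriv_def partials_def mi_list_def)
qed

lemma count_mi_list [simp]: "count_list (mi_list i) = i"
proof
  fix k :: 'a
  have rep: "count_list (replicate n j) k = (if j = k then n else 0)" for n and j :: 'a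
    by (induction n) auto
  have "distinct js \<Longrightarrow> count_list (concat (map (\<lambda>j. replicate (i j) j) js)) k
      = (if k \<in> set js then i k else 0)" for js :: "'a list"
    by (induction js) (auto simp: rep count_list_append)
  then show "count_list (mi_list i) k = i k"
    by (simp add: mi_list_def coords)
qed

lemma length_mi_list [simp]: "length (mi_list i) = mi_len i"
  using sum_count_set[of "mi_list i" UNIV] by (simp add: mi_len_def)

subsection \<open>Monomials centred at a point\<close>

definition mono_at :: "real^'n::finite \<Rightarrow> ('n \<Rightarrow> nat) \<Rightarrow> real^'n \<Rightarrow> real" where
  "mono_at t m x = (\<Prod>j\<in>UNIV. (x $ j - t $ j) ^ m j)"

text \<open>For \<open>m j = 0\<close> truncated subtraction leaves \<open>m\<close> unchanged, but
  then the factor \<open>real (m j)\<close> vanishes, as it should.\<close>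

lemma partial_mono_at:
  fixes j :: "'n::finite"
  shows "has_partial j (mono_at t m) x"
    "partial j (mono_at t m) x = real (m j) * mono_at t (m(j := m j - 1)) x"
proof -
  \<comment> \<open>Along the line in direction \<open>axis j 1\<close> only the factor with index
    \<open>j\<close> varies; \<open>R\<close> is the product of the constant ones.\<close>
  define R where "R = (\<Prod>k\<in>UNIV - {j}. (x $ k - t $ k) ^ m k)"
  have split: "mono_at t m' y = (y $ j - t $ j) ^ m' j * (\<Prod>k\<in>UNIV - {j}. (y $ k - t $ k) ^ m' k)"
    for m' y
    unfolding mono_at_def by (rule prod.remove) auto
  have 1: "mono_at t m (x + s *\<^sub>R axis j 1) = (x $ j + s - t $ j) ^ m j * R" for s
    unfolding split R_def by (auto simp: axis_def intro!: prod.cong arg_cong2[of _ _ _ _ "(*)"])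
  have 2: "mono_at t (m(j := m j - 1)) x = (x $ j - t $ j) ^ (m j - 1) * R"
    unfolding split R_def by auto
  have "((\<lambda>s. mono_at t m (x + s *\<^sub>R axis j 1)) has_field_derivative
      real (m j) * mono_at t (m(j := m j - 1)) x) (at 0)"
    unfolding 1 2 by (auto intro!: derivative_eq_intros)
  from partialI[OF this] show "has_partial j (mono_at t m) x"
    "partial j (mono_at t m) x = real (m j) * mono_at t (m(j := m j - 1)) x" by auto
qed

lemma partial_mono_at_fun:
  "partial j (mono_at t m) = (\<lambda>x. real (m j) * mono_at t (m(j := m j - 1)) x)"
  by (rule ext) (rule partial_mono_at(2))

lemma C_on_mono_at:
  assumes "open T"
  shows "C_on k T (mono_at t m)"
proof (induction k arbitrary: m)
  case 0
  show ?case unfolding mono_at_def C_on.simps by (intro continuous_intros)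
next
  case (Suc k)
  have "continuous_on T (mono_at t m)"
    unfolding mono_at_def by (intro continuous_intros)
  moreover have "C_on k T (partial j (mono_at t m))" for j
    unfolding partial_mono_at_fun by (rule C_on_cmult[OF assms Suc])
  ultimately show ?case by (simp add: partial_mono_at)
qed

text \<open>Equality fails exactly when \<open>m j = 0\<close>, where truncated subtraction changes
  nothing.\<close>

lemma mi_len_dec: "mi_len m \<le> Suc (mi_len (m(j := m j - 1)))"
proof -
  have "mi_len m = m j + (\<Sum>k\<in>UNIV - {j}. m k)"
    "mi_len (m(j := m j - 1)) = (m j - 1) + (\<Sum>k\<in>UNIV - {j}. m k)"
    unfolding mi_len_def by (subst sum.remove[of _ j]; simp)+
  then show ?thesis by simp
qed

text \<open>The value at \<open>t\<close> of the derivative along \<open>js\<close> of the monomial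
  \<open>mono_at t m\<close>. It depends on \<open>js\<close> only through the counts, so it is
  symmetric in the order of differentiation.\<close>

definition mono_jet :: "'n::finite list \<Rightarrow> ('n \<Rightarrow> nat) \<Rightarrow> real" where
  "mono_jet js m = (if count_list js = m then \<Prod>j\<in>UNIV. fact (m j) else 0)"

text \<open>The combinatorial counterpart of the rule for differentiating a monomial. If
  \<open>m j = 0\<close>, both sides vanish because \<open>j\<close> occurs in the longer
  list.\<close>

lemma mono_jet_snoc: "mono_jet (js @ [j]) m = real (m j) * mono_jet js (m(j := m j - 1))"
proof (cases "m j")
  case 0
  then have "count_list (js @ [j]) \<noteq> m"
    by (auto simp: fun_eq_iff intro!: exI[of _ j])
  with 0 show ?thesis by (simp add: mono_jet_def)
next
  case (Suc n)
  define c where "c = count_list js"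
  have c: "count_list (js @ [j]) = c(j := Suc (c j))"
    unfolding c_def by (rule ext) simp
  \<comment> \<open>Lowering the exponent of \<open>j\<close> and raising the count of
    \<open>j\<close> undo each other; here \<open>m j > 0\<close> matters.\<close>
  have "m = (m(j := m j - 1))(j := Suc ((m(j := m j - 1)) j))"
    using Suc by (simp add: fun_eq_iff)
  moreover have "c = (c(j := Suc (c j)))(j := (c(j := Suc (c j))) j - 1)"
    by simp
  ultimately have iff: "count_list (js @ [j]) = m \<longleftrightarrow> count_list js = m(j := m j - 1)"
    unfolding c c_def[symmetric] by metis
  have "(\<Prod>k\<in>UNIV. fact (m k) :: real) = fact (m j) * (\<Prod>k\<in>UNIV - {j}. fact (m k))"
    by (rule prod.remove) auto
  also have "\<dots> = real (m j) * (fact (m j - 1) * (\<Prod>k\<in>UNIV - {j}. fact (m k)))"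
    using Suc by simp
  also have "fact (m j - 1) * (\<Prod>k\<in>UNIV - {j}. fact (m k) :: real)
      = (\<Prod>k\<in>UNIV. fact ((m(j := m j - 1)) k))"
    by (subst (2) prod.remove[of _ j]) auto
  finally have fact: "(\<Prod>k\<in>UNIV. fact (m k) :: real)
      = real (m j) * (\<Prod>k\<in>UNIV. fact ((m(j := m j - 1)) k))" .
  show ?thesis
    unfolding mono_jet_def iff fact by (simp only: if_distrib[of "(*) (real (m j))"] mult_zero_right)
qed

lemma length_eq_mi_len_count: "length js = mi_len (count_list js)"
  using sum_count_set[of js UNIV] by (simp add: mi_len_def)

text \<open>A wrong total order already excludes equal counts. This is what removes the lower-order
  terms of the operator.\<close>

lemma mono_jet_eq_0: "length js \<noteq> mi_len m \<Longrightarrow> mono_jet js m = 0"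
  by (auto simp: mono_jet_def length_eq_mi_len_count)

text \<open>All \<open>length js\<close> derivatives are needed to make the monomial nonzero at its centre, so none is
  left for \<open>g\<close>.\<close>

lemma partials_mult_mono_at:
  assumes "open T" "t \<in> T" "C_on (length js) T g" "length js \<le> mi_len m"
  shows "partials js (\<lambda>x. g x * mono_at t m x) t = g t * mono_jet js m"
  using assms(3-)
proof (induction js arbitrary: g m rule: rev_induct)
  case Nil
  have "mono_at t m t = mono_jet [] m"
    by (auto simp: mono_at_def mono_jet_def power_0_left fun_eq_iff)
  then show ?case by simp
next
  case (snoc j js)
  let ?m = "m(j := m j - 1)"
  have g: "C_on (length js) T g" "C_on (length js) T (partial j g)"
    "\<And>x. x \<in> T \<Longrightarrow> has_partial j g x"
    using snoc.prems(1) by (auto intro: C_on_Suc_imp)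
  note C = C_on_mult[OF assms(1) _ C_on_mono_at[OF assms(1)]] C_on_cmult[OF assms(1)]
  have len: "length js < mi_len m" "length js \<le> mi_len ?m"
    using snoc.prems(2) mi_len_dec[of m j] by auto
  have "partials js (partial j (\<lambda>x. g x * mono_at t m x)) t
      = partials js (\<lambda>x. partial j g x * mono_at t m x + real (m j) * (g x * mono_at t ?m x)) t"
    by (rule partials_cong[OF assms(1) _ assms(2)])
      (use g(3) in \<open>auto simp: partial_mult partial_mono_at\<close>)
  also have "\<dots> = partials js (\<lambda>x. partial j g x * mono_at t m x) t
      + real (m j) * partials js (\<lambda>x. g x * mono_at t ?m x) t"
    using g by (simp add: partials_add[OF assms(1) _ _ assms(2)]
      partials_cmult[OF assms(1) _ assms(2)] C)
  \<comment> \<open>In the first summand a derivative has been spent on \<open>g\<close>, so fewer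
    than \<open>|m|\<close> are left and its jet is 0; the second one is the jet of the longer
    list.\<close>
  also have "\<dots> = g t * mono_jet (js @ [j]) m"
    unfolding snoc.IH[OF g(2) less_imp_le[OF len(1)]] snoc.IH[OF g(1) len(2)]
    using len(1) by (simp add: mono_jet_eq_0 mono_jet_snoc)
  finally show ?case by simp
qed

text \<open>After \<open>|m|\<close> or more derivatives a monomial is constant, so the value found
  at the centre holds at every \<open>x\<close>.\<close>

lemma partials_mono_at_const:
  assumes "mi_len m \<le> length js"
  shows "partials js (mono_at t m) x = mono_jet js m"
  using assms
proof (induction js arbitrary: m rule: rev_induct)
  case Nil
  then have "m = (\<lambda>_. 0)" by (auto simp: mi_len_def)
  then show ?case by (auto simp: mono_at_def mono_jet_def)
next
  case (snoc j js)
  let ?m = "m(j := m j - 1)"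
  have "partials js (partial j (mono_at t m)) x = partials js (\<lambda>x. real (m j) * mono_at t ?m x) x"
    by (simp only: partial_mono_at_fun)
  also have "\<dots> = real (m j) * partials js (mono_at t ?m) x"
    by (rule partials_cmult[OF open_UNIV C_on_mono_at[OF open_UNIV] UNIV_I])
  also have "\<dots> = mono_jet (js @ [j]) m"
  proof (cases "m j")
    case (Suc n)
    have "mi_len ?m < mi_len m"
      unfolding mi_len_def by (rule sum_strict_mono_ex1) (use Suc in auto)
    moreover have "mi_len m \<le> Suc (length js)"
      using snoc.prems by simp
    ultimately have "mi_len ?m \<le> length js"
      by linarith
    then have "partials js (mono_at t ?m) x = mono_jet js ?m"
      by (rule snoc.IH)
    then show ?thesis by (simp only: mono_jet_snoc)
  qed (simp add: mono_jet_snoc)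
  finally show ?case by simp
qed

subsection \<open>The differential operator on monomials\<close>

text \<open>At a point of the open set \<open>T\<close> the operator sees only values on
  \<open>T\<close>. Test polynomials cut off outside \<open>T\<close> may thus be replaced by
  genuine monomials.\<close>

lemma diff_op_cong:
  assumes "open T" "x \<in> T" "\<And>y. y \<in> T \<Longrightarrow> u y = v y"
  shows "diff_op K \<beta> \<sigma> u x = diff_op K \<beta> \<sigma> v x"
proof -
  have "grad u y = grad v y" if "y \<in> T" for y
    unfolding grad_def using partial_cong(2)[OF assms(1) that assms(3)] by simp
  then have "dvg (\<lambda>y. - (K y *v grad u y) + u y *\<^sub>R \<beta> y) x
      = dvg (\<lambda>y. - (K y *v grad v y) + v y *\<^sub>R \<beta> y) x"
    unfolding dvg_def by (intro sum.cong refl partial_cong(2)[OF assms(1,2)]) (simp add: assms(3))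
  then show ?thesis
    unfolding diff_op_def using assms(2,3) by simp
qed

text \<open>Here \<open>n\<close> bounds the order of the conditions. \<open>K\<close> and
  \<open>\<beta>\<close> are one order smoother than \<open>\<sigma>\<close> because the divergence
  differentiates them once.\<close>

locale diff_coeffs =
  fixes T :: "(real^'n::finite) set" and K :: "real^'n \<Rightarrow> real^'n^'n"
    and \<beta> :: "real^'n \<Rightarrow> real^'n" and \<sigma> :: "real^'n \<Rightarrow> real" and n :: nat
  assumes open_T: "open T"
    and K: "\<And>j k. C_on (Suc n) T (\<lambda>x. K x $ j $ k)"
    and \<beta>: "\<And>j. C_on (Suc n) T (\<lambda>x. \<beta> x $ j)"
    and \<sigma>: "C_on n T \<sigma>"
begin

section \<open>Non-divergence form and linearity of the operator\<close>

definition drift :: "'n \<Rightarrow> real^'n \<Rightarrow> real" where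
  "drift k x = \<beta> x $ k + (\<Sum>j\<in>UNIV. - 1 * partial j (\<lambda>y. K y $ j $ k) x)"

definition reaction :: "real^'n \<Rightarrow> real" where
  "reaction x = (\<Sum>j\<in>UNIV. partial j (\<lambda>y. \<beta> y $ j) x) + \<sigma> x"

lemma C_on_drift: "C_on n T (drift k)"
proof -
  have "C_on n T (partial j (\<lambda>y. K y $ j $ k))" for j
    using K by simp
  then show ?thesis
    unfolding drift_def by (intro C_on_add C_on_sum C_on_cmult open_T C_on_Suc_imp[OF \<beta>]) auto
qed

lemma C_on_reaction: "C_on n T reaction"
proof -
  have "C_on n T (partial j (\<lambda>y. \<beta> y $ j))" for j
    using \<beta> by simp
  then show ?thesis
    unfolding reaction_def by (intro C_on_add C_on_sum open_T \<sigma>) auto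
qed

text \<open>Expanding the divergence moves the derivatives of \<open>K\<close> into the first-order
  coefficient and those of \<open>\<beta>\<close> into the zeroth-order one. The sign is a factor
  \<open>- 1\<close> so that rules for products apply.\<close>

definition nondiv :: "(real^'n \<Rightarrow> real) \<Rightarrow> real^'n \<Rightarrow> real" where
  "nondiv v x = (\<Sum>(j, k)\<in>UNIV. (- 1 * K x $ j $ k) * partial j (partial k v) x)
      + (\<Sum>k\<in>UNIV. drift k x * partial k v x) + reaction x * v x"

lemma C_on_nondiv:
  assumes "C_on (Suc (Suc n)) T v"
  shows "C_on n T (nondiv v)"
proof -
  have 1: "C_on (Suc n) T v" "C_on n T v"
    using assms by (blast intro: C_on_Suc_imp)+
  have 2: "C_on n T (partial k v)" for k
    using 1 by simp
  have 3: "C_on n T (partial j (partial k v))" for j k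
    using assms by simp
  show ?thesis
    unfolding nondiv_def case_prod_unfold
    by (intro C_on_add C_on_sum C_on_mult open_T C_on_const C_on_drift C_on_reaction 1 2 3
        C_on_Suc_imp[OF K] finite)
qed

lemma diff_op_eq_nondiv:
  assumes v: "C_on (Suc (Suc n)) T v" and x: "x \<in> T"
  shows "diff_op K \<beta> \<sigma> v x = nondiv v x"
proof -
  have hv: "has_partial j v x" "has_partial j (partial k v) x" for j k
    using v x by auto
  have hK: "has_partial j (\<lambda>y. K y $ i $ k) x" and h\<beta>: "has_partial j (\<lambda>y. \<beta> y $ k) x" for i j k
    using K \<beta> x by auto
  have flux: "(- (K y *v grad v y) + v y *\<^sub>R \<beta> y) $ j
      = - 1 * (\<Sum>k\<in>UNIV. K y $ j $ k * partial k v y) + v y * \<beta> y $ j" for j y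
    by (simp add: matrix_vector_mult_def grad_def)
  have flux_deriv: "partial j (\<lambda>y. (- (K y *v grad v y) + v y *\<^sub>R \<beta> y) $ j) x
      = (\<Sum>k\<in>UNIV. (- 1 * K x $ j $ k) * partial j (partial k v) x)
        + (\<Sum>k\<in>UNIV. (- 1 * partial j (\<lambda>y. K y $ j $ k) x) * partial k v x)
        + \<beta> x $ j * partial j v x + partial j (\<lambda>y. \<beta> y $ j) x * v x" for j
  proof -
    have h1: "has_partial j (\<lambda>y. K y $ j $ k * partial k v y) x" for k
      by (intro partial_mult hK hv)
    have h2: "has_partial j (\<lambda>y. \<Sum>k\<in>UNIV. K y $ j $ k * partial k v y) x"
      by (intro partial_sum h1) auto
    have h3: "has_partial j (\<lambda>y. v y * \<beta> y $ j) x"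
      by (intro partial_mult hv h\<beta>)
    have "partial j (\<lambda>y. (- (K y *v grad v y) + v y *\<^sub>R \<beta> y) $ j) x
        = - 1 * (\<Sum>k\<in>UNIV. partial j (\<lambda>y. K y $ j $ k) x * partial k v x
            + K x $ j $ k * partial j (partial k v) x)
          + (partial j v x * \<beta> x $ j + v x * partial j (\<lambda>y. \<beta> y $ j) x)"
      unfolding flux partial_add[OF partial_cmult(1)[OF h2] h3] partial_cmult[OF h2]
        partial_sum(2)[OF finite h1] partial_mult(2)[OF hK hv(2)] partial_mult(2)[OF hv(1) h\<beta>] ..
    then show ?thesis
      by (simp add: sum.distrib sum_negf)
  qed
  \<comment> \<open>The coefficient of \<open>partial k v\<close> collects the derivatives of column
    \<open>k\<close> of \<open>K\<close>, so \<open>k\<close> has to become the outer index.\<close>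
  have swap: "(\<Sum>j\<in>UNIV. \<Sum>k\<in>UNIV. (- 1 * partial j (\<lambda>y. K y $ j $ k) x) * partial k v x)
      = (\<Sum>k\<in>UNIV. (\<Sum>j\<in>UNIV. - 1 * partial j (\<lambda>y. K y $ j $ k) x) * partial k v x)"
    unfolding sum_distrib_right by (rule sum.swap)
  show ?thesis
    unfolding diff_op_def dvg_def flux_deriv nondiv_def sum.distrib swap drift_def reaction_def
    by (simp only: UNIV_Times_UNIV[symmetric] sum.cartesian_product[symmetric] sum.distrib
        distrib_right sum_distrib_right add.assoc add.commute add.left_commute)
qed

lemma C_on_diff_op: "C_on (Suc (Suc n)) T v \<Longrightarrow> C_on n T (diff_op K \<beta> \<sigma> v)"
  by (rule C_on_cong[OF open_T diff_op_eq_nondiv, THEN iffD2, OF _ _ C_on_nondiv])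

lemma diff_op_linear:
  assumes u: "C_on (Suc (Suc n)) T u" and v: "C_on (Suc (Suc n)) T v" and x: "x \<in> T"
  shows "diff_op K \<beta> \<sigma> (\<lambda>y. u y + c * v y) x = diff_op K \<beta> \<sigma> u x + c * diff_op K \<beta> \<sigma> v x"
proof -
  have w: "C_on (Suc (Suc n)) T (\<lambda>y. u y + c * v y)"
    by (intro C_on_add C_on_cmult open_T u v)
  have h: "has_partial j u y" "has_partial j v y"
    "has_partial j (partial k u) y" "has_partial j (partial k v) y" if "y \<in> T" for j k y
    using that u v by auto
  have p1: "partial k (\<lambda>y. u y + c * v y) y = partial k u y + c * partial k v y"
    if "y \<in> T" for k y
    using h[OF that] by (simp add: partial_add partial_cmult)
  \<comment> \<open>The identity \<open>p1\<close> holds on all of the open set \<open>T\<close>, so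
    it may be differentiated once more at \<open>x\<close>.\<close>
  have p2: "partial j (partial k (\<lambda>y. u y + c * v y)) x
      = partial j (partial k u) x + c * partial j (partial k v) x" for j k
    using partial_cong(2)[OF open_T x p1] h[OF x] by (simp add: partial_add partial_cmult)
  have "nondiv (\<lambda>y. u y + c * v y) x = nondiv u x + c * nondiv v x"
    unfolding nondiv_def p1[OF x] p2 case_prod_unfold
    by (simp add: algebra_simps sum.distrib sum_distrib_left sum_negf sum_subtractf)
  then show ?thesis
    using assms w by (simp only: diff_op_eq_nondiv)
qed

lemma mi_deriv_diff_op_linear:
  assumes u: "C_on (Suc (Suc n)) T u" and v: "C_on (Suc (Suc n)) T v" and x: "x \<in> T"
    and i: "mi_len i \<le> n"
  shows "mi_deriv i (diff_op K \<beta> \<sigma> (\<lambda>y. u y + c * v y)) x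
      = mi_deriv i (diff_op K \<beta> \<sigma> u) x + c * mi_deriv i (diff_op K \<beta> \<sigma> v) x"
proof -
  note C = C_on_mono[OF i C_on_diff_op[OF u]] C_on_mono[OF i C_on_diff_op[OF v]]
  have "partials (mi_list i) (diff_op K \<beta> \<sigma> (\<lambda>y. u y + c * v y)) x
      = partials (mi_list i) (\<lambda>y. diff_op K \<beta> \<sigma> u y + c * diff_op K \<beta> \<sigma> v y) x"
    by (rule partials_cong[OF open_T diff_op_linear[OF u v] x])
  also have "\<dots> = partials (mi_list i) (diff_op K \<beta> \<sigma> u) x
      + c * partials (mi_list i) (diff_op K \<beta> \<sigma> v) x"
    using C x open_T C_on_cmult[OF open_T C(2)]
    by (subst partials_add[of T]) (simp_all add: partials_cmult[of T])
  finally show ?thesis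
    by (simp add: mi_deriv_eq_partials)
qed

section \<open>Derivatives at \<open>t\<close> of the image of a monomial centred at
  \<open>t\<close>\<close>

lemma partials_mult_partial_mono_at:
  assumes "t \<in> T" "C_on (length js) T g" "length js < mi_len m"
  shows "partials js (\<lambda>x. g x * partial k (mono_at t m) x) t = g t * mono_jet (js @ [k]) m"
proof -
  let ?m = "m(k := m k - 1)"
  have "length js \<le> mi_len ?m"
    using assms(3) mi_len_dec[of m k] by linarith
  note jet = partials_mult_mono_at[OF open_T assms(1) _ this]
  \<comment> \<open>The derivative of the monomial is a multiple of another monomial; the factor is
    absorbed into the coefficient \<open>g\<close> and returned by
    \<open>mono_jet_snoc\<close>.\<close>
  have "partials js (\<lambda>x. g x * partial k (mono_at t m) x) t
      = partials js (\<lambda>x. real (m k) * g x * mono_at t ?m x) t"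
    by (simp only: partial_mono_at mult.assoc mult.left_commute)
  also have "\<dots> = g t * mono_jet (js @ [k]) m"
    using jet[OF C_on_cmult[OF open_T assms(2), of "real (m k)"]] by (simp add: mono_jet_snoc)
  finally show ?thesis .
qed

lemma partials_mult_partial2_mono_at:
  assumes "t \<in> T" "C_on (length js) T g" "length js + 2 \<le> mi_len m"
  shows "partials js (\<lambda>x. g x * partial j (partial k (mono_at t m)) x) t
    = g t * mono_jet (js @ [j, k]) m"
proof -
  let ?m = "m(k := m k - 1)"
  have len: "length js < mi_len ?m"
    using assms(3) mi_len_dec[of m k] by linarith
  have "partials js (\<lambda>x. g x * partial j (partial k (mono_at t m)) x) t
      = partials js (\<lambda>x. real (m k) * g x * partial j (mono_at t ?m) x) t"
    by (simp only: partial_mono_at_fun[of k] partial_cmult[OF partial_mono_at(1)]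
        mult.assoc mult.left_commute)
  also have "\<dots> = g t * mono_jet (js @ [j, k]) m"
    using partials_mult_partial_mono_at[OF assms(1) C_on_cmult[OF open_T assms(2)] len]
      mono_jet_snoc[of "js @ [j]" k m] by simp
  finally show ?thesis .
qed

text \<open>First- and zeroth-order terms leave the monomial with fewer than \<open>|m|\<close>
  derivatives, so they vanish at \<open>t\<close>. In the second-order terms all of
  \<open>js\<close> must fall on the monomial, which freezes \<open>K\<close> at
  \<open>t\<close>.\<close>

lemma partials_diff_op_mono_at:
  assumes t: "t \<in> T" and js: "length js \<le> n" "length js + 2 \<le> mi_len m"
  shows "partials js (diff_op K \<beta> \<sigma> (mono_at t m)) t
    = - (\<Sum>(j, k)\<in>UNIV. K t $ j $ k * mono_jet (js @ [j, k]) m)"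
proof -
  note C = C_on_mono_at[OF open_T, of _ t m]
  have P1: "C_on l T (partial k (mono_at t m))" for k l
    using C[of "Suc l"] by simp
  have P2: "C_on l T (partial j (partial k (mono_at t m)))" for j k l
    using P1[where l = "Suc l" and k = k] by simp
  have CK: "C_on (length js) T (\<lambda>x. - 1 * K x $ j $ k)" for j k
    by (intro C_on_cmult open_T C_on_mono[OF js(1)] C_on_Suc_imp[OF K])
  note Cd = C_on_mono[OF js(1) C_on_drift] and Cr = C_on_mono[OF js(1) C_on_reaction]
  define A1 where "A1 = (\<lambda>x. \<Sum>(j, k)\<in>UNIV. (- 1 * K x $ j $ k) * partial j (partial k (mono_at t m)) x)"
  define A2 where "A2 = (\<lambda>x. \<Sum>k\<in>UNIV. drift k x * partial k (mono_at t m) x)"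
  define A3 where "A3 = (\<lambda>x. reaction x * mono_at t m x)"
  have CA: "C_on (length js) T A1" "C_on (length js) T A2" "C_on (length js) T A3"
    unfolding A1_def A2_def A3_def case_prod_unfold
    by (intro C_on_sum C_on_mult open_T CK Cd Cr C P1 P2 finite)+
  have "partials js (diff_op K \<beta> \<sigma> (mono_at t m)) t = partials js (nondiv (mono_at t m)) t"
    by (rule partials_cong[OF open_T diff_op_eq_nondiv[OF C] t])
  also have "nondiv (mono_at t m) = (\<lambda>x. A1 x + A2 x + A3 x)"
    by (rule ext) (simp only: nondiv_def A1_def A2_def A3_def)
  also have "partials js (\<lambda>x. A1 x + A2 x + A3 x) t
      = partials js A1 t + partials js A2 t + partials js A3 t"
    using CA C_on_add[OF open_T CA(1,2)] open_T t by (simp only: partials_add[of T])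
  also have "partials js A1 t = - (\<Sum>(j, k)\<in>UNIV. K t $ j $ k * mono_jet (js @ [j, k]) m)"
    unfolding A1_def case_prod_unfold
    by (subst partials_sum[OF open_T finite C_on_mult[OF open_T CK P2] t],
        subst partials_mult_partial2_mono_at[OF t CK js(2)])
      (simp add: sum_negf)
  also have "partials js A2 t = 0"
  proof -
    have "partials js A2 t = (\<Sum>k\<in>UNIV. partials js (\<lambda>x. drift k x * partial k (mono_at t m) x) t)"
      unfolding A2_def by (rule partials_sum[OF open_T finite C_on_mult[OF open_T Cd P1] t])
    also have "\<dots> = (\<Sum>k\<in>UNIV. drift k t * mono_jet (js @ [k]) m)"
      using js(2) by (intro sum.cong refl partials_mult_partial_mono_at[OF t Cd]) simp
    also have "\<dots> = 0"
      using js(2) by (simp add: mono_jet_eq_0)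
    finally show ?thesis .
  qed
  also have "partials js A3 t = 0"
    unfolding A3_def using js(2)
    by (subst partials_mult_mono_at[OF open_T t Cr]) (simp_all add: mono_jet_eq_0)
  finally show ?thesis by simp
qed

text \<open>This is the triangularity of the matrix of conditions: a nonzero jet forces
  \<open>|i'| = |i|\<close>, then \<open>j = k = a\<close>, and finally
  \<open>i' = i\<close>.\<close>

lemma mi_deriv_diff_op_mono_at:
  assumes t: "t \<in> T" and i': "mi_len i' \<le> n" "mi_len i' \<le> mi_len i"
    "mi_len i' = mi_len i \<Longrightarrow> i' a \<le> i a"
  shows "mi_deriv i' (diff_op K \<beta> \<sigma> (mono_at t (i(a := i a + 2)))) t
    = (if i' = i then - (K t $ a $ a * (\<Prod>j\<in>UNIV. fact ((i(a := i a + 2)) j))) else 0)"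
proof -
  let ?m = "i(a := i a + 2)"
  have len: "mi_len ?m = mi_len i + 2"
  proof -
    have "mi_len ?m = (\<Sum>j\<in>UNIV. i j + (if j = a then 2 else 0))"
      unfolding mi_len_def by (rule sum.cong) auto
    then show ?thesis by (simp add: sum.distrib mi_len_def)
  qed
  have cnt: "count_list (mi_list i' @ [j, k]) l
      = i' l + (if j = l then 1 else 0) + (if k = l then 1 else 0)" for j k l
    by simp
  have zero: "count_list (mi_list i' @ [j, k]) \<noteq> ?m" if "(i', j, k) \<noteq> (i, a, a)" for j k
  proof
    assume eq: "count_list (mi_list i' @ [j, k]) = ?m"
    have "mi_len i' + 2 = mi_len ?m"
      using arg_cong[OF eq, of mi_len] length_eq_mi_len_count[of "mi_list i' @ [j, k]"] by simp
    then have "i' a \<le> i a"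
      using len i' by simp
    moreover have at: "i' l + (if j = l then 1 else 0) + (if k = l then 1 else 0) = ?m l" for l
      using fun_cong[OF eq, of l] unfolding cnt .
    \<comment> \<open>At coordinate \<open>a\<close> the count \<open>i' a\<close> is raised by at
      most 2 and must reach \<open>i a + 2\<close>. As \<open>i' a \<le> i a\<close>, both extra
      derivatives are in direction \<open>a\<close>.\<close>
    ultimately have jk: "j = a" "k = a"
      using at[of a] by (cases "j = a"; cases "k = a"; simp)+
    have "i' l = i l" for l
      using at[of l] jk by (cases "l = a") auto
    with jk that show False by auto
  qed
  have "mono_jet (mi_list i' @ [j, k]) ?m
      = (if (i', j, k) = (i, a, a) then \<Prod>j\<in>UNIV. fact (?m j) else 0)" for j k
  proof (cases "(i', j, k) = (i, a, a)")
    case True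
    then have "count_list (mi_list i' @ [j, k]) = ?m"
      by (intro ext) (auto simp: cnt)
    with True show ?thesis by (simp only: mono_jet_def simp_thms if_True)
  next
    case False
    with zero[OF False] show ?thesis by (simp only: mono_jet_def if_False)
  qed
  then have "partials (mi_list i') (diff_op K \<beta> \<sigma> (mono_at t ?m)) t
      = - (\<Sum>(j, k)\<in>UNIV. K t $ j $ k *
          (if (i', j, k) = (i, a, a) then \<Prod>j\<in>UNIV. fact (?m j) else 0))"
    using t i' len by (subst partials_diff_op_mono_at) simp_all
  also have "\<dots> = - (\<Sum>q\<in>UNIV. if q = (a, a)
      then if i' = i then K t $ a $ a * (\<Prod>j\<in>UNIV. fact (?m j)) else 0 else 0)"
    by (intro arg_cong[where f = uminus] sum.cong refl) (auto split: if_splits)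
  also have "\<dots> = (if i' = i then - (K t $ a $ a * (\<Prod>j\<in>UNIV. fact (?m j))) else 0)"
    by simp
  finally show ?thesis
    by (simp only: mi_deriv_eq_partials)
qed

end

subsection \<open>Families of functions and of functionals\<close>

lemma sum_fun_apply: "(\<Sum>i\<in>I. f i) x = (\<Sum>i\<in>I. f i x :: 'b::comm_monoid_add)"
  by (induction I rule: infinite_finite_induct) simp_all

text \<open>Coefficients are indexed by \<open>I\<close> and not by the image set, so repeated
  members of the family are allowed.\<close>

lemma span_family:
  fixes b :: "'i \<Rightarrow> 'a \<Rightarrow> real"
  assumes "finite I"
  shows "fun_space.span (b ` I) = {v. \<exists>c. v = (\<lambda>x. \<Sum>i\<in>I. c i * b i x)}" (is "_ = ?S")
proof
  have "fun_space.subspace ?S"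
  proof (rule fun_space.subspaceI)
    show "0 \<in> ?S"
      by (auto simp: fun_eq_iff intro!: exI[of _ "\<lambda>_. 0"])
  next
    fix u v assume "u \<in> ?S" "v \<in> ?S"
    then obtain c d where "u = (\<lambda>x. \<Sum>i\<in>I. c i * b i x)" "v = (\<lambda>x. \<Sum>i\<in>I. d i * b i x)"
      by blast
    then show "u + v \<in> ?S"
      by (auto simp: fun_eq_iff distrib_right sum.distrib intro!: exI[of _ "\<lambda>i. c i + d i"])
  next
    fix a :: real and u assume "u \<in> ?S"
    then obtain c where "u = (\<lambda>x. \<Sum>i\<in>I. c i * b i x)"
      by blast
    then show "(\<lambda>x. a * u x) \<in> ?S"
      by (auto simp: fun_eq_iff sum_distrib_left mult.assoc intro!: exI[of _ "\<lambda>i. a * c i"])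
  qed
  moreover have "b ` I \<subseteq> ?S"
  proof clarify
    fix k assume "k \<in> I"
    then have "b k x = (\<Sum>i\<in>I. (if i = k then 1 else 0) * b i x)" for x
      using assms by (simp add: if_distrib[of "\<lambda>r. r * _"] cong: if_cong)
    then show "\<exists>c. b k = (\<lambda>x. \<Sum>i\<in>I. c i * b i x)"
      by (intro exI[of _ "\<lambda>i. if i = k then 1 else 0"] ext)
  qed
  ultimately show "fun_space.span (b ` I) \<subseteq> ?S"
    by (intro fun_space.span_minimal)
next
  show "?S \<subseteq> fun_space.span (b ` I)"
  proof clarify
    fix c :: "'i \<Rightarrow> real"
    have "(\<Sum>i\<in>I. (\<lambda>x. c i * b i x)) \<in> fun_space.span (b ` I)"
      by (intro fun_space.span_sum fun_space.span_scale fun_space.span_base) simp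
    also have "(\<Sum>i\<in>I. (\<lambda>x. c i * b i x)) = (\<lambda>x. \<Sum>i\<in>I. c i * b i x)"
      by (simp add: fun_eq_iff sum_fun_apply)
    finally show "(\<lambda>x. \<Sum>i\<in>I. c i * b i x) \<in> fun_space.span (b ` I)" .
  qed
qed

text \<open>Independence over the index set makes \<open>b\<close> injective:
  \<open>b i = b k\<close> would give a relation with coefficients 1 and -1. Hence the image is a
  basis with \<open>card I\<close> elements.\<close>

lemma dim_span_family:
  fixes b :: "'i \<Rightarrow> 'a \<Rightarrow> real"
  assumes "finite I"
    and indep: "\<And>c. (\<And>x. (\<Sum>i\<in>I. c i * b i x) = 0) \<Longrightarrow> \<forall>i\<in>I. c i = 0"
  shows "fun_space.dim (fun_space.span (b ` I)) = card I"
proof -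
  have inj: "inj_on b I"
  proof (rule inj_onI, rule ccontr)
    fix i k assume ik: "i \<in> I" "k \<in> I" "b i = b k" "i \<noteq> k"
    define c where "c l = (if l = i then 1 else 0) - (if l = k then 1 else 0 :: real)" for l
    have "(\<Sum>l\<in>I. c l * b l x) = 0" for x
    proof -
      have "(\<Sum>l\<in>I. c l * b l x)
          = (\<Sum>l\<in>I. if l = i then b l x else 0) - (\<Sum>l\<in>I. if l = k then b l x else 0)"
        unfolding sum_subtractf[symmetric] c_def by (rule sum.cong) auto
      then show ?thesis
        using ik assms(1) by simp
    qed
    from indep[OF this] ik have "c i = 0" by blast
    with ik show False by (simp add: c_def)
  qed
  have "fun_space.independent (b ` I)"
  proof (rule fun_space.independent_if_scalars_zero)
    fix f x assume 0: "(\<Sum>v\<in>b ` I. (\<lambda>y. f v * v y)) = 0" and x: "x \<in> b ` I"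
    have "(\<Sum>i\<in>I. f (b i) * b i y) = 0" for y
      using fun_cong[OF 0, of y] by (simp add: sum_fun_apply sum.reindex[OF inj])
    from indep[OF this] x show "f x = 0" by blast
  qed (use assms in simp)
  from trans[OF fun_space.dim_span_eq_card_independent[OF this] card_image[OF inj]]
  show ?thesis .
qed

section \<open>Linear functionals and the dimension of their common kernel\<close>

definition linear_on :: "('a \<Rightarrow> real) set \<Rightarrow> (('a \<Rightarrow> real) \<Rightarrow> real) \<Rightarrow> bool" where
  "linear_on V \<Lambda> \<longleftrightarrow> (\<forall>u\<in>V. \<forall>v\<in>V. \<forall>c. \<Lambda> (\<lambda>x. u x + c * v x) = \<Lambda> u + c * \<Lambda> v)"

lemma subspace_add_cmult:
  assumes "fun_space.subspace V" "u \<in> V" "v \<in> V"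
  shows "(\<lambda>x. u x + c * v x) \<in> V"
  using fun_space.subspace_add[OF assms(1,2) fun_space.subspace_scale[OF assms(1,3), of c]]
  by (simp add: plus_fun_def)

lemma subspace_lincomb:
  assumes "fun_space.subspace V" "\<And>i. i \<in> I \<Longrightarrow> u i \<in> V"
  shows "(\<lambda>x. \<Sum>i\<in>I. c i * u i x) \<in> V"
proof -
  have "(\<Sum>i\<in>I. (\<lambda>x. c i * u i x)) \<in> V"
    by (intro fun_space.subspace_sum fun_space.subspace_scale assms)
  also have "(\<Sum>i\<in>I. (\<lambda>x. c i * u i x)) = (\<lambda>x. \<Sum>i\<in>I. c i * u i x)"
    by (simp add: fun_eq_iff sum_fun_apply)
  finally show ?thesis .
qed

lemma linear_onD:
  "linear_on V \<Lambda> \<Longrightarrow> u \<in> V \<Longrightarrow> v \<in> V \<Longrightarrow> \<Lambda> (\<lambda>x. u x + c * v x) = \<Lambda> u + c * \<Lambda> v"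
  by (simp add: linear_on_def)

lemma linear_on_lincomb:
  assumes V: "fun_space.subspace V" and \<Lambda>: "linear_on V \<Lambda>"
    and I: "finite I" "\<And>i. i \<in> I \<Longrightarrow> u i \<in> V"
  shows "\<Lambda> (\<lambda>x. \<Sum>i\<in>I. c i * u i x) = (\<Sum>i\<in>I. c i * \<Lambda> (u i))"
  using I
proof (induction I rule: finite_induct)
  case empty
  have "(\<lambda>x. 0) \<in> V"
    using fun_space.subspace_0[OF V] by (simp add: zero_fun_def)
  \<comment> \<open>With \<open>u = v = 0\<close> and \<open>c = 1\<close>, linearity reads
    \<open>\<Lambda> 0 = 2 * \<Lambda> 0\<close>, so \<open>\<Lambda> 0 = 0\<close>.\<close>
  then have "\<Lambda> (\<lambda>x. 0 + 1 * 0) = \<Lambda> (\<lambda>x. 0) + 1 * \<Lambda> (\<lambda>x. 0)"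
    by (intro linear_onD[OF \<Lambda>])
  then show ?case by simp
next
  case (insert i I)
  have "\<Lambda> (\<lambda>x. (\<Sum>i\<in>I. c i * u i x) + c i * u i x)
      = \<Lambda> (\<lambda>x. \<Sum>i\<in>I. c i * u i x) + c i * \<Lambda> (u i)"
    using insert.prems by (intro linear_onD[OF \<Lambda>] subspace_lincomb[OF V]) auto
  with insert show ?case by (simp add: add.commute)
qed

text \<open>Induction on the set of functionals. A vector is made invisible to the old functionals
  by subtracting its components along the old dual vectors; independence provides one that the new
  functional still detects.\<close>

lemma dual_vectors:
  fixes \<Lambda> :: "'i \<Rightarrow> ('a \<Rightarrow> real) \<Rightarrow> real"
  assumes V: "fun_space.subspace V" and "finite I"
    and "\<And>i. i \<in> I \<Longrightarrow> linear_on V (\<Lambda> i)" and "lin_indep_functionals V I \<Lambda>"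
  obtains u where "\<And>i. i \<in> I \<Longrightarrow> u i \<in> V"
    "\<And>i k. i \<in> I \<Longrightarrow> k \<in> I \<Longrightarrow> \<Lambda> k (u i) = (if i = k then 1 else 0)"
proof -
  have "\<exists>u. \<forall>i\<in>I. u i \<in> V \<and> (\<forall>k\<in>I. \<Lambda> k (u i) = (if i = k then 1 else 0))"
    using assms(2-)
  proof (induction I rule: finite_induct)
    case (insert a I)
    have "lin_indep_functionals V I \<Lambda>"
      unfolding lin_indep_functionals_def
    proof (intro allI impI)
      fix c assume c: "\<forall>v\<in>V. (\<Sum>i\<in>I. c i * \<Lambda> i v) = 0"
      \<comment> \<open>A relation among the old functionals is extended by the coefficient 0 at
        \<open>a\<close>.\<close>
      have "(\<Sum>i\<in>insert a I. (c(a := 0)) i * \<Lambda> i v) = (\<Sum>i\<in>I. c i * \<Lambda> i v)" for v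
        using insert.hyps by (simp, intro sum.cong) auto
      then have "\<forall>i\<in>insert a I. (c(a := 0)) i = 0"
        using insert.prems(2) c unfolding lin_indep_functionals_def by metis
      then show "\<forall>i\<in>I. c i = 0"
        using insert.hyps by (metis fun_upd_other insertI2)
    qed
    then obtain u where u: "\<And>i. i \<in> I \<Longrightarrow> u i \<in> V"
      "\<And>i k. i \<in> I \<Longrightarrow> k \<in> I \<Longrightarrow> \<Lambda> k (u i) = (if i = k then 1 else 0)"
      using insert.IH insert.prems(1) by (metis insertI2)
    have proj: "(\<lambda>x. v x + (- 1) * (\<Sum>i\<in>I. \<Lambda> i v * u i x)) \<in> V"
      "\<And>k. k \<in> insert a I \<Longrightarrow> \<Lambda> k (\<lambda>x. v x + (- 1) * (\<Sum>i\<in>I. \<Lambda> i v * u i x))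
        = \<Lambda> k v - (\<Sum>i\<in>I. \<Lambda> i v * \<Lambda> k (u i))" if v: "v \<in> V" for v
    proof -
      have lc: "(\<lambda>x. \<Sum>i\<in>I. \<Lambda> i v * u i x) \<in> V"
        by (rule subspace_lincomb[OF V u(1)])
      show "(\<lambda>x. v x + (- 1) * (\<Sum>i\<in>I. \<Lambda> i v * u i x)) \<in> V"
        by (rule subspace_add_cmult[OF V v lc])
      fix k assume k: "k \<in> insert a I"
      have "\<Lambda> k (\<lambda>x. v x + (- 1) * (\<Sum>i\<in>I. \<Lambda> i v * u i x))
          = \<Lambda> k v + (- 1) * \<Lambda> k (\<lambda>x. \<Sum>i\<in>I. \<Lambda> i v * u i x)"
        by (rule linear_onD[OF insert.prems(1)[OF k] v lc])
      also have "\<Lambda> k (\<lambda>x. \<Sum>i\<in>I. \<Lambda> i v * u i x) = (\<Sum>i\<in>I. \<Lambda> i v * \<Lambda> k (u i))"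
        by (rule linear_on_lincomb[OF V insert.prems(1)[OF k] insert.hyps(1) u(1)])
      finally show "\<Lambda> k (\<lambda>x. v x + (- 1) * (\<Sum>i\<in>I. \<Lambda> i v * u i x))
        = \<Lambda> k v - (\<Sum>i\<in>I. \<Lambda> i v * \<Lambda> k (u i))" by simp
    qed
    \<comment> \<open>Otherwise \<open>\<Lambda> a\<close> would be the combination of the old
      functionals with coefficients \<open>\<Lambda> a (u i)\<close>, a relation with coefficient 1
      at \<open>a\<close>.\<close>
    have "\<exists>v\<in>V. \<Lambda> a v - (\<Sum>i\<in>I. \<Lambda> i v * \<Lambda> a (u i)) \<noteq> 0"
    proof (rule ccontr)
      assume "\<not> ?thesis"
      moreover define c where "c i = (if i = a then 1 else - \<Lambda> a (u i))" for i
      have "(\<Sum>i\<in>insert a I. c i * \<Lambda> i v) = \<Lambda> a v - (\<Sum>i\<in>I. \<Lambda> i v * \<Lambda> a (u i))" for v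
      proof -
        have "(\<Sum>i\<in>I. c i * \<Lambda> i v) = (\<Sum>i\<in>I. - (\<Lambda> i v * \<Lambda> a (u i)))"
          by (rule sum.cong) (use insert.hyps in \<open>auto simp: c_def\<close>)
        then show ?thesis
          using insert.hyps by (simp add: c_def sum_negf)
      qed
      ultimately have "\<forall>v\<in>V. (\<Sum>i\<in>insert a I. c i * \<Lambda> i v) = 0" by simp
      then have "c a = 0"
        using insert.prems(2) unfolding lin_indep_functionals_def by blast
      then show False by (simp add: c_def)
    qed
    then obtain v where v: "v \<in> V" "\<Lambda> a v - (\<Sum>i\<in>I. \<Lambda> i v * \<Lambda> a (u i)) \<noteq> 0"
      by blast
    define r where "r = \<Lambda> a v - (\<Sum>i\<in>I. \<Lambda> i v * \<Lambda> a (u i))"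
    define p where "p = (\<lambda>x. v x + (- 1) * (\<Sum>i\<in>I. \<Lambda> i v * u i x))"
    have p: "p \<in> V" and \<Lambda>p: "\<Lambda> k p = (if k = a then r else 0)" if "k \<in> insert a I" for k
    proof -
      have "(\<Sum>i\<in>I. \<Lambda> i v * \<Lambda> k (u i)) = \<Lambda> k v" if "k \<in> I"
      proof -
        have "(\<Sum>i\<in>I. \<Lambda> i v * \<Lambda> k (u i)) = (\<Sum>i\<in>I. if i = k then \<Lambda> i v else 0)"
          by (rule sum.cong) (use u(2) that in auto)
        with that insert.hyps show ?thesis by simp
      qed
      then show "\<Lambda> k p = (if k = a then r else 0)"
        using proj(2)[OF v(1) that] that unfolding p_def r_def by auto
      show "p \<in> V" unfolding p_def by (rule proj(1)[OF v(1)])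
    qed
    \<comment> \<open>The new dual vector is \<open>p\<close> normalised by
      \<open>r = \<Lambda> a p\<close>; each old one is corrected by a multiple of \<open>p\<close>
      so that \<open>\<Lambda> a\<close> vanishes on it. The summand \<open>0\<close> gives the
      shape that \<open>linear_onD\<close> expects.\<close>
    define u' where "u' i = (if i = a then (\<lambda>x. 0 + (1 / r) * p x)
        else (\<lambda>x. u i x + (- \<Lambda> a (u i) / r) * p x))" for i
    have zero: "(\<lambda>x. 0) \<in> V"
      using fun_space.subspace_0[OF V] by (simp add: zero_fun_def)
    have r: "r \<noteq> 0" using v(2) unfolding r_def .
    have "u' i \<in> V \<and> (\<forall>k\<in>insert a I. \<Lambda> k (u' i) = (if i = k then 1 else 0))"
      if i: "i \<in> insert a I" for i
    proof (cases "i = a")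
      case True
      have "\<Lambda> k (u' i) = (if i = k then 1 else 0)" if k: "k \<in> insert a I" for k
      proof -
        have "\<Lambda> k (\<lambda>x. 0 + (1 / r) * p x) = \<Lambda> k (\<lambda>x. 0) + (1 / r) * \<Lambda> k p"
          by (rule linear_onD[OF insert.prems(1)[OF k] zero p[OF k]])
        moreover have "\<Lambda> k (\<lambda>x. 0) = 0"
          using linear_on_lincomb[OF V insert.prems(1)[OF k], of "{}"] by simp
        ultimately show ?thesis
          using True \<Lambda>p[OF k] r by (auto simp: u'_def)
      qed
      moreover have "u' i \<in> V"
        unfolding u'_def if_P[OF True] by (rule subspace_add_cmult[OF V zero p[OF i]])
      ultimately show ?thesis by blast
    next
      case False
      with i have iI: "i \<in> I" by simp
      have "\<Lambda> k (u' i) = (if i = k then 1 else 0)" if k: "k \<in> insert a I" for k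
      proof -
        have "\<Lambda> k (\<lambda>x. u i x + (- \<Lambda> a (u i) / r) * p x)
            = \<Lambda> k (u i) + (- \<Lambda> a (u i) / r) * \<Lambda> k p"
          by (rule linear_onD[OF insert.prems(1)[OF k] u(1)[OF iI] p[OF k]])
        then show ?thesis
          using False \<Lambda>p[OF k] r k u(2)[OF iI] by (auto simp: u'_def)
      qed
      moreover have "u' i \<in> V"
        unfolding u'_def if_not_P[OF False] by (rule subspace_add_cmult[OF V u(1)[OF iI] p[OF i]])
      ultimately show ?thesis by blast
    qed
    then show ?case by blast
  qed simp
  then show ?thesis using that by blast
qed

text \<open>A basis \<open>B\<close> of the kernel and the dual vectors \<open>u\<close> form a
  basis of \<open>V\<close>: applying \<open>\<Lambda> k\<close> to a relation isolates the
  coefficient of \<open>u k\<close>, and subtracting \<open>\<Lambda> i v\<close> times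
  \<open>u i\<close> for all \<open>i\<close> puts any \<open>v\<close> into the kernel.\<close>

lemma dim_common_kernel:
  fixes \<Lambda> :: "'i \<Rightarrow> ('a \<Rightarrow> real) \<Rightarrow> real"
  assumes V: "fun_space.subspace V" "V \<subseteq> fun_space.span S" "finite S" and I: "finite I"
    and \<Lambda>: "\<And>i. i \<in> I \<Longrightarrow> linear_on V (\<Lambda> i)" and indep: "lin_indep_functionals V I \<Lambda>"
  shows "fun_space.dim V = fun_space.dim {v \<in> V. \<forall>i\<in>I. \<Lambda> i v = 0} + card I"
proof -
  define U where "U = {v \<in> V. \<forall>i\<in>I. \<Lambda> i v = 0}"
  obtain u where u: "\<And>i. i \<in> I \<Longrightarrow> u i \<in> V"
    "\<And>i k. i \<in> I \<Longrightarrow> k \<in> I \<Longrightarrow> \<Lambda> k (u i) = (if i = k then 1 else 0)"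
    using dual_vectors[OF V(1) I \<Lambda> indep] by blast
  obtain B where B: "B \<subseteq> U" "fun_space.independent B" "U \<subseteq> fun_space.span B"
    "card B = fun_space.dim U"
    using fun_space.basis_exists .
  have BV: "B \<subseteq> V" using B(1) by (auto simp: U_def)
  have finB: "finite B"
    using fun_space.independent_span_bound[OF V(3) B(2)] BV V(2) by auto
  \<comment> \<open>Indexing by the disjoint sum lets \<open>dim_span_family\<close> also establish
    that all these vectors are distinct.\<close>
  define b where "b = case_sum (\<lambda>v. v) u"
  have "fun_space.dim (fun_space.span (b ` (B <+> I))) = card (B <+> I)"
  proof (rule dim_span_family)
    show "finite (B <+> I)" using finB I by simp
    fix c assume c: "\<And>x. (\<Sum>s\<in>B <+> I. c s * b s x) = 0"
    have split: "(\<Sum>v\<in>B. c (Inl v) * v x) + (\<Sum>i\<in>I. c (Inr i) * u i x) = 0" for x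
      using c[of x] finB I by (simp add: sum.Plus b_def)
    have cI: "c (Inr k) = 0" if k: "k \<in> I" for k
    proof -
      have "0 = \<Lambda> k (\<lambda>x. \<Sum>i\<in>{}. 0 * u i x)"
        using linear_on_lincomb[OF V(1) \<Lambda>[OF k], of "{}"] by simp
      also have "(\<lambda>x. \<Sum>i\<in>{}. 0 * u i x)
          = (\<lambda>x. (\<Sum>v\<in>B. c (Inl v) * v x) + 1 * (\<Sum>i\<in>I. c (Inr i) * u i x))"
        by (simp add: split)
      also have "\<Lambda> k \<dots> = \<Lambda> k (\<lambda>x. \<Sum>v\<in>B. c (Inl v) * v x)
          + 1 * \<Lambda> k (\<lambda>x. \<Sum>i\<in>I. c (Inr i) * u i x)"
        using BV u(1) by (intro linear_onD[OF \<Lambda>[OF k]] subspace_lincomb[OF V(1)]) auto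
      also have "\<Lambda> k (\<lambda>x. \<Sum>v\<in>B. c (Inl v) * v x) = (\<Sum>v\<in>B. c (Inl v) * \<Lambda> k v)"
        using BV by (intro linear_on_lincomb[OF V(1) \<Lambda>[OF k] finB]) auto
      also have "\<dots> = 0"
        using B(1) k by (intro sum.neutral) (auto simp: U_def)
      also have "\<Lambda> k (\<lambda>x. \<Sum>i\<in>I. c (Inr i) * u i x) = (\<Sum>i\<in>I. c (Inr i) * \<Lambda> k (u i))"
        by (rule linear_on_lincomb[OF V(1) \<Lambda>[OF k] I u(1)])
      also have "\<dots> = (\<Sum>i\<in>I. if i = k then c (Inr i) else 0)"
        by (rule sum.cong) (use u(2) k in auto)
      also have "\<dots> = c (Inr k)"
        using k I by simp
      finally show ?thesis by simp
    qed
    have "(\<Sum>v\<in>B. (\<lambda>x. c (Inl v) * v x)) = 0"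
      using split by (simp add: fun_eq_iff sum_fun_apply cI)
    then have "c (Inl v) = 0" if "v \<in> B" for v
      using fun_space.independentD[OF B(2) finB subset_refl _ that, of "\<lambda>v. c (Inl v)"] by simp
    with cI show "\<forall>s\<in>B <+> I. c s = 0" by auto
  qed
  moreover have "fun_space.span (b ` (B <+> I)) = V"
  proof
    show "fun_space.span (b ` (B <+> I)) \<subseteq> V"
      using BV u(1) by (intro fun_space.span_minimal V(1)) (auto simp: b_def)
  next
    show "V \<subseteq> fun_space.span (b ` (B <+> I))" (is "_ \<subseteq> ?W")
    proof
      fix v assume v: "v \<in> V"
      define q where "q = (\<lambda>x. \<Sum>i\<in>I. \<Lambda> i v * u i x)"
      have qV: "q \<in> V"
        unfolding q_def by (rule subspace_lincomb[OF V(1) u(1)])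
      have "\<Lambda> k (\<lambda>x. v x + (- 1) * q x) = 0" if k: "k \<in> I" for k
      proof -
        have "\<Lambda> k (\<lambda>x. v x + (- 1) * q x) = \<Lambda> k v + (- 1) * \<Lambda> k q"
          by (rule linear_onD[OF \<Lambda>[OF k] v qV])
        also have "\<Lambda> k q = (\<Sum>i\<in>I. \<Lambda> i v * \<Lambda> k (u i))"
          unfolding q_def by (rule linear_on_lincomb[OF V(1) \<Lambda>[OF k] I u(1)])
        also have "\<dots> = (\<Sum>i\<in>I. if i = k then \<Lambda> i v else 0)"
          by (rule sum.cong) (use u(2) k in auto)
        finally show ?thesis using k I by simp
      qed
      then have "(\<lambda>x. v x + (- 1) * q x) \<in> U"
        using subspace_add_cmult[OF V(1) v qV, of "- 1"] unfolding U_def by blast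
      moreover have "B \<subseteq> b ` (B <+> I)"
        by (force simp: b_def image_iff)
      ultimately have 1: "(\<lambda>x. v x + (- 1) * q x) \<in> ?W"
        using B(3) fun_space.span_mono by blast
      have "u i \<in> ?W" if "i \<in> I" for i
        using that by (intro fun_space.span_base) (force simp: b_def image_iff)
      then have "q \<in> ?W"
        unfolding q_def by (intro subspace_lincomb fun_space.subspace_span)
      from subspace_add_cmult[OF fun_space.subspace_span 1 this, of 1] show "v \<in> ?W"
        by simp
    qed
  qed
  ultimately show ?thesis
    using finB I B(4) by (simp add: card_Plus U_def)
qed

subsection \<open>Counting multi-indices\<close>

text \<open>Stars and bars: the slack \<open>p - mi_len i\<close> becomes an extra entry, turning
  the bound into an equation for lists of \<open>d + 1\<close> summands, with
  \<open>d = CARD('n)\<close>.\<close>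

lemma bij_betw_mi_lists:
  "bij_betw (\<lambda>i. (p - mi_len i) # map i coords) {i :: 'n::finite \<Rightarrow> nat. mi_len i \<le> p}
     {l. length l = CARD('n) + 1 \<and> sum_list l = p}"
proof -
  have len: "length (coords :: 'n list) = CARD('n)"
    using coords distinct_card by metis
  have sum: "sum_list (map i coords) = mi_len i" for i :: "'n \<Rightarrow> nat"
    by (simp add: sum_list_distinct_conv_sum_set coords mi_len_def)
  show ?thesis
  proof (rule bij_betwI')
    fix i k :: "'n \<Rightarrow> nat"
    show "((p - mi_len i) # map i coords = (p - mi_len k) # map k coords) = (i = k)"
      by (auto simp: coords)
  next
    fix i :: "'n \<Rightarrow> nat" assume "i \<in> {i. mi_len i \<le> p}"
    then show "(p - mi_len i) # map i coords \<in> {l. length l = CARD('n) + 1 \<and> sum_list l = p}"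
      by (simp add: len sum)
  next
    fix l :: "nat list" assume "l \<in> {l. length l = CARD('n) + 1 \<and> sum_list l = p}"
    then obtain h t where l: "l = h # t" "length t = CARD('n)" "h + sum_list t = p"
      by (cases l) auto
    \<comment> \<open>The value at \<open>j\<close> is the entry of \<open>t\<close> at the position
      of \<open>j\<close> in \<open>coords\<close>.\<close>
    define i :: "'n \<Rightarrow> nat" where "i = (\<lambda>j. t ! inv_into {..<CARD('n)} ((!) coords) j)"
    have inj: "inj_on ((!) (coords :: 'n list)) {..<CARD('n)}"
      by (rule inj_on_nth[OF coords(1)]) (simp add: len)
    have t: "map i coords = t"
      by (rule nth_equalityI) (simp_all add: l len i_def inv_into_f_f[OF inj])
    with l sum[of i] show "\<exists>i\<in>{i :: 'n \<Rightarrow> nat. mi_len i \<le> p}. l = (p - mi_len i) # map i coords"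
      by (intro bexI[of _ i]) auto
  qed
qed

lemma card_mi_len_le:
  "card {i :: 'n::finite \<Rightarrow> nat. mi_len i \<le> p} = (p + CARD('n)) choose CARD('n)"
proof -
  have "bij_betw (\<lambda>i. (p - mi_len i) # map i coords) {i :: 'n \<Rightarrow> nat. mi_len i \<le> p}
     {l. length l = CARD('n) + 1 \<and> sum_list l = p}"
    by (rule bij_betw_mi_lists)
  from bij_betw_same_card[OF this] show ?thesis
    using card_length_sum_list[of "CARD('n) + 1" p] binomial_symmetric[of p "p + CARD('n)"] by simp
qed

text \<open>An infinite set has cardinality 0, whereas the binomial coefficient is positive.\<close>

lemma finite_mi_len_le: "finite {i :: 'n::finite \<Rightarrow> nat. mi_len i \<le> p}"
proof (rule card_ge_0_finite)
  show "0 < card {i :: 'n \<Rightarrow> nat. mi_len i \<le> p}"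
    unfolding card_mi_len_le by simp
qed

subsection \<open>The polynomial space\<close>

lemma poly_space_eq_span:
  "poly_space p T = fun_space.span ((\<lambda>i x. if x \<in> T then mono_at 0 i x else 0) ` {i. mi_len i \<le> p})"
proof -
  have "(\<lambda>x. if x \<in> T then \<Sum>i\<in>{i. mi_len i \<le> p}. c i * (\<Prod>j\<in>UNIV. (x $ j) ^ i j) else 0)
      = (\<lambda>x. \<Sum>i\<in>{i. mi_len i \<le> p}. c i * (if x \<in> T then mono_at 0 i x else 0))" for c
    by (rule ext) (simp add: mono_at_def)
  then show ?thesis
    unfolding poly_space_def span_family[OF finite_mi_len_le] by simp
qed

section \<open>Change of centre for polynomials of bounded degree\<close>

lemma mono_at_mult_coord:
  "(x $ j - t $ j) * mono_at t m x = mono_at t (m(j := m j + 1)) x"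
proof -
  have split: "mono_at t m' x = (x $ j - t $ j) ^ m' j * (\<Prod>k\<in>UNIV - {j}. (x $ k - t $ k) ^ m' k)" for m'
    unfolding mono_at_def by (rule prod.remove) auto
  show ?thesis
    unfolding split by simp
qed

lemma mi_len_upd_Suc: "mi_len (m(j := m j + 1)) = mi_len m + 1"
proof -
  have "mi_len (m(j := m j + 1)) = (\<Sum>k\<in>UNIV. m k + (if k = j then 1 else 0))"
    unfolding mi_len_def by (rule sum.cong) auto
  then show ?thesis by (simp add: sum.distrib mi_len_def)
qed

text \<open>The functions whose product with \<open>x $ j - s\<close> lies in the larger span form a
  subspace, which leaves only the monomials to be checked.\<close>

lemma mult_coord_in_span:
  assumes "f \<in> fun_space.span (mono_at 0 ` {i. mi_len i \<le> p})"
  shows "(\<lambda>x. (x $ j - s) * f x) \<in> fun_space.span (mono_at 0 ` {i. mi_len i \<le> Suc p})"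
    (is "_ \<in> ?W")
proof -
  have W: "fun_space.subspace ?W" by (rule fun_space.subspace_span)
  have "fun_space.span (mono_at 0 ` {i. mi_len i \<le> p}) \<subseteq> {f. (\<lambda>x. (x $ j - s) * f x) \<in> ?W}"
  proof (rule fun_space.span_minimal)
    show "mono_at 0 ` {i. mi_len i \<le> p} \<subseteq> {f. (\<lambda>x. (x $ j - s) * f x) \<in> ?W}"
    proof clarify
      fix i :: "'a \<Rightarrow> nat" assume i: "mi_len i \<le> p"
      have "mono_at 0 (i(j := i j + 1)) \<in> ?W" "mono_at 0 i \<in> ?W"
        using i mi_len_upd_Suc[of i j]
        by (auto intro!: fun_space.span_base imageI simp del: fun_upd_apply)
      \<comment> \<open>The product is the monomial with \<open>i j\<close> raised by one, minus
        \<open>s\<close> times the original monomial.\<close>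
      from subspace_add_cmult[OF W this, of "- s"]
      show "(\<lambda>x. (x $ j - s) * mono_at 0 i x) \<in> ?W"
        unfolding mono_at_mult_coord[symmetric] by (simp add: algebra_simps)
    qed
    show "fun_space.subspace {f. (\<lambda>x. (x $ j - s) * f x) \<in> ?W}"
    proof (rule fun_space.subspaceI)
      show "0 \<in> {f. (\<lambda>x. (x $ j - s) * f x) \<in> ?W}"
        using fun_space.subspace_0[OF W] by (simp add: zero_fun_def)
    next
      fix f g assume "f \<in> {f. (\<lambda>x. (x $ j - s) * f x) \<in> ?W}" "g \<in> {f. (\<lambda>x. (x $ j - s) * f x) \<in> ?W}"
      then show "f + g \<in> {f. (\<lambda>x. (x $ j - s) * f x) \<in> ?W}"
        using fun_space.subspace_add[OF W, of "\<lambda>x. (x $ j - s) * f x" "\<lambda>x. (x $ j - s) * g x"]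
        by (simp add: plus_fun_def distrib_left)
    next
      fix c :: real and f assume "f \<in> {f. (\<lambda>x. (x $ j - s) * f x) \<in> ?W}"
      then show "(\<lambda>x. c * f x) \<in> {f. (\<lambda>x. (x $ j - s) * f x) \<in> ?W}"
        using fun_space.subspace_scale[OF W, of "\<lambda>x. (x $ j - s) * f x" c]
        by (simp add: mult.left_commute)
    qed
  qed
  with assms show ?thesis by blast
qed

text \<open>Splitting off one factor \<open>x $ j - t $ j\<close> at a time takes the place of a
  binomial expansion in several variables.\<close>

lemma mono_at_in_span:
  assumes "mi_len m \<le> p"
  shows "mono_at t m \<in> fun_space.span (mono_at 0 ` {i. mi_len i \<le> p})"
  using assms
proof (induction p arbitrary: m)
  case 0
  then have "m = (\<lambda>_. 0)" by (auto simp: mi_len_def)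
  then have "mono_at t m = mono_at 0 m" "mi_len m \<le> 0"
    by (simp_all add: mono_at_def fun_eq_iff mi_len_def)
  then show ?case by (auto intro!: fun_space.span_base)
next
  case (Suc p)
  show ?case
  proof (cases "mi_len m \<le> p")
    case True
    have "mono_at 0 ` {i. mi_len i \<le> p} \<subseteq> mono_at 0 ` {i. mi_len i \<le> Suc p}"
      by auto
    from fun_space.span_mono[OF this] Suc.IH[OF True] show ?thesis by blast
  next
    case False
    then have "mi_len m \<noteq> 0" by simp
    then obtain j where j: "m j \<noteq> 0" by (auto simp: mi_len_def)
    define k where "k = m(j := m j - 1)"
    have m: "m = k(j := k j + 1)"
      using j by (simp add: k_def fun_eq_iff)
    have "mi_len k \<le> p"
      using Suc.prems mi_len_upd_Suc[of k j] unfolding m[symmetric] by simp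
    from mult_coord_in_span[OF Suc.IH[OF this], of j "t $ j"]
    show ?thesis
      unfolding mono_at_mult_coord m[symmetric] .
  qed
qed

lemma restrict_mono_at_in_poly_space:
  assumes "mi_len m \<le> p"
  shows "(\<lambda>x. if x \<in> T then mono_at t m x else 0) \<in> poly_space p T"
proof -
  obtain c where "mono_at t m = (\<lambda>x. \<Sum>i\<in>{i. mi_len i \<le> p}. c i * mono_at 0 i x)"
    using mono_at_in_span[OF assms, of t] unfolding span_family[OF finite_mi_len_le] by blast
  then show ?thesis
    unfolding poly_space_def by (auto simp: fun_eq_iff mono_at_def intro!: exI[of _ c])
qed

lemma C_on_poly_space:
  assumes "open T" "v \<in> poly_space p T"
  shows "C_on k T v"
proof -
  obtain c where "v = (\<lambda>x. \<Sum>i\<in>{i. mi_len i \<le> p}. c i * (if x \<in> T then mono_at 0 i x else 0))"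
    using assms(2) unfolding poly_space_eq_span span_family[OF finite_mi_len_le] by blast
  then have eq: "v x = (\<Sum>i\<in>{i. mi_len i \<le> p}. c i * mono_at 0 i x)" if "x \<in> T" for x
    using that by simp
  have "C_on k T (\<lambda>x. \<Sum>i\<in>{i. mi_len i \<le> p}. c i * mono_at 0 i x)"
    by (intro C_on_sum C_on_cmult C_on_mono_at assms(1) finite_mi_len_le)
  moreover have "C_on k T v \<longleftrightarrow> C_on k T (\<lambda>x. \<Sum>i\<in>{i. mi_len i \<le> p}. c i * mono_at 0 i x)"
    by (rule C_on_cong[OF assms(1)]) (rule eq)
  ultimately show ?thesis by blast
qed

lemma finite_has_max_value:
  fixes f :: "'a \<Rightarrow> 'b::linorder"
  assumes "finite A" "A \<noteq> {}"
  shows "\<exists>x\<in>A. \<forall>y\<in>A. f y \<le> f x"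
proof -
  have "Max (f ` A) \<in> f ` A"
    using assms by (intro Max_in) auto
  then obtain x where "x \<in> A" "f x = Max (f ` A)"
    by (metis imageE)
  then show ?thesis
    using assms by (intro bexI[of _ x]) auto
qed

text \<open>A relation among the monomials is differentiated along an index \<open>i\<close> of
  maximal length with nonzero coefficient; all monomials left are then constant and only that of
  \<open>i\<close> survives. Their centre 0 may lie outside \<open>T\<close>, hence the use of
  \<open>partials_mono_at_const\<close>.\<close>

lemma dim_poly_space:
  fixes T :: "(real^'n::finite) set"
  assumes T: "open T" "t \<in> T"
  shows "fun_space.dim (poly_space p T) = (p + CARD('n)) choose CARD('n)"
proof -
  let ?J = "{i :: 'n \<Rightarrow> nat. mi_len i \<le> p}"
  have "fun_space.dim (poly_space p T) = card ?J"
    unfolding poly_space_eq_span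
  proof (rule dim_span_family[OF finite_mi_len_le], rule ccontr)
    fix c assume c: "\<And>x. (\<Sum>i\<in>?J. c i * (if x \<in> T then mono_at 0 i x else 0)) = 0"
      and "\<not> (\<forall>i\<in>?J. c i = 0)"
    then have "finite {i \<in> ?J. c i \<noteq> 0}" "{i \<in> ?J. c i \<noteq> 0} \<noteq> {}"
      using finite_mi_len_le[of p, where 'n = 'n] by auto
    from finite_has_max_value[OF this, of mi_len]
    obtain i where i: "mi_len i \<le> p" "c i \<noteq> 0"
      and max: "\<And>k. mi_len k \<le> p \<Longrightarrow> c k \<noteq> 0 \<Longrightarrow> mi_len k \<le> mi_len i"
      by auto
    have 0: "(\<Sum>k\<in>?J. c k * mono_at 0 k x) = 0" if "x \<in> T" for x
      using c[of x] that by simp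
    have "0 = partials (mi_list i) (\<lambda>x. \<Sum>k\<in>?J. c k * mono_at 0 k x) t"
      using partials_cong[OF T(1) 0 T(2)] by (simp only: partials_zero)
    also have "\<dots> = (\<Sum>k\<in>?J. partials (mi_list i) (\<lambda>x. c k * mono_at 0 k x) t)"
      by (rule partials_sum[OF T(1) finite_mi_len_le C_on_cmult[OF T(1) C_on_mono_at[OF T(1)]] T(2)])
    also have "\<dots> = (\<Sum>k\<in>?J. if k = i then c i * (\<Prod>j\<in>UNIV. fact (i j)) else 0)"
    proof (rule sum.cong[OF refl])
      fix k assume k: "k \<in> ?J"
      have "partials (mi_list i) (\<lambda>x. c k * mono_at 0 k x) t
          = c k * partials (mi_list i) (mono_at 0 k) t"
        by (rule partials_cmult[OF T(1) C_on_mono_at[OF T(1)] T(2)])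
      also have "\<dots> = (if k = i then c i * (\<Prod>j\<in>UNIV. fact (i j)) else 0)"
      proof (cases "c k = 0")
        case False
        then show ?thesis
          using max[of k] k by (simp add: partials_mono_at_const mono_jet_def)
      qed (use i in auto)
      finally show "partials (mi_list i) (\<lambda>x. c k * mono_at 0 k x) t
          = (if k = i then c i * (\<Prod>j\<in>UNIV. fact (i j)) else 0)" .
    qed
    also have "\<dots> = c i * (\<Prod>j\<in>UNIV. fact (i j))"
      using i finite_mi_len_le[of p, where 'n = 'n] by simp
    finally show False using i by simp
  qed
  then show ?thesis by (simp add: card_mi_len_le)
qed

subsection \<open>Independence of the quasi-Trefftz conditions\<close>

lemma qt_indices_iff: "i \<in> qt_indices p \<longleftrightarrow> mi_len i + 2 \<le> p"
  by (auto simp: qt_indices_def)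

lemma finite_qt_indices: "finite (qt_indices p :: ('n::finite \<Rightarrow> nat) set)"
  by (rule finite_subset[OF _ finite_mi_len_le[of p]]) (auto simp: qt_indices_iff)

lemma card_qt_indices:
  "int (card (qt_indices p :: ('n::finite \<Rightarrow> nat) set))
    = binom (int p + int CARD('n) - 2) CARD('n)"
proof (cases "p < 2")
  case True
  then have "qt_indices p = ({} :: ('n \<Rightarrow> nat) set)"
    by (auto simp: qt_indices_iff)
  \<comment> \<open>For \<open>p < 2\<close> the upper entry is smaller than the lower one; it is
    \<open>-1\<close> for \<open>p = 0\<close>, \<open>d = 1\<close>. Either way the coefficient is
    0.\<close>
  moreover have "nat (int p + int CARD('n) - 2) < CARD('n)"
    using True zero_less_card_finite[where 'a = 'n] by linarith
  ultimately show ?thesis by (simp add: binom_def)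
next
  case False
  then have "qt_indices p = {i :: 'n \<Rightarrow> nat. mi_len i \<le> p - 2}"
    by (auto simp: qt_indices_iff)
  moreover have "int p + int CARD('n) - 2 = int (p - 2 + CARD('n))"
    using False by simp
  ultimately show ?thesis
    by (simp only: card_mi_len_le binom_def nat_int) simp
qed

context
  fixes p T xT K \<beta> \<sigma>
  assumes qt: "qt_setting p (T :: (real^'n::finite) set) xT K \<beta> \<sigma>"
begin

lemma qt_open: "open T" and qt_mem: "xT \<in> T"
  using qt by (auto simp: qt_setting_def mesh_element_def)

lemma qt_diff_coeffs: "diff_coeffs T K \<beta> \<sigma> (p - 2)"
proof -
  \<comment> \<open>Truncated subtraction gives order \<open>n = 0\<close> for \<open>p < 2\<close>,
    in agreement with the maxima in the regularity hypotheses.\<close>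
  have "max (p - 1) 1 = Suc (p - 2)" "max (p - 2) 0 = p - 2" by auto
  then show ?thesis
    using qt unfolding qt_setting_def mesh_element_def diff_coeffs_def by auto
qed

text \<open>The quadratic form at the unit vector \<open>axis a 1\<close> is the diagonal
  entry.\<close>

lemma qt_elliptic: "K xT $ a $ a > 0"
proof -
  obtain k where "k > 0" "\<And>\<xi>. \<xi> \<bullet> (K xT *v \<xi>) \<ge> k * (norm \<xi>)\<^sup>2"
    using qt unfolding qt_setting_def by blast
  from this(1) this(2)[of "axis a 1"] show ?thesis
    by (simp add: inner_axis' matrix_vector_mul_component inner_axis)
qed

lemma linear_on_qt_functional:
  assumes "i \<in> qt_indices p"
  shows "linear_on (poly_space p T) (\<lambda>v. mi_deriv i (diff_op K \<beta> \<sigma> v) xT)"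
  unfolding linear_on_def
  using assms
  by (auto intro!: diff_coeffs.mi_deriv_diff_op_linear[OF qt_diff_coeffs] C_on_poly_space qt_open qt_mem
      simp: qt_indices_iff)

text \<open>A nontrivial relation is tested on the monomial attached to the largest index with a
  nonzero coefficient. By triangularity only the diagonal term remains, and it is nonzero.\<close>

lemma lin_indep_qt_functionals:
  "lin_indep_functionals (poly_space p T) (qt_indices p) (\<lambda>i v. mi_deriv i (diff_op K \<beta> \<sigma> v) xT)"
  unfolding lin_indep_functionals_def
proof (intro allI impI, rule ccontr)
  fix c
  assume c: "\<forall>v\<in>poly_space p T. (\<Sum>i\<in>qt_indices p. c i * mi_deriv i (diff_op K \<beta> \<sigma> v) xT) = 0"
    and "\<not> (\<forall>i\<in>qt_indices p. c i = 0)"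
  \<comment> \<open>Any fixed coordinate serves, as every diagonal entry of \<open>K xT\<close> is
    positive.\<close>
  define a :: 'n where "a = undefined"
  \<comment> \<open>The lexicographic order of \<open>(|i|, i a)\<close> in a single number: on
    \<open>qt_indices p\<close> the second component is at most \<open>p\<close>, below the base
    \<open>Suc p\<close>.\<close>
  define key where "key i = mi_len i * Suc p + i a" for i
  have le: "i a \<le> mi_len i" for i :: "'n \<Rightarrow> nat"
    unfolding mi_len_def by (rule member_le_sum) auto
  let ?C = "{i \<in> qt_indices p. c i \<noteq> 0}"
  have "finite ?C" "?C \<noteq> {}"
    using finite_subset[OF _ finite_qt_indices, of ?C p] \<open>\<not> _\<close> by auto
  from finite_has_max_value[OF this, of key]
  obtain i where i: "i \<in> qt_indices p" "c i \<noteq> 0"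
    and max: "\<And>k. k \<in> qt_indices p \<Longrightarrow> c k \<noteq> 0 \<Longrightarrow> key k \<le> key i"
    by auto
  have lex: "mi_len k \<le> mi_len i" "mi_len k = mi_len i \<Longrightarrow> k a \<le> i a"
    if k: "k \<in> qt_indices p" "c k \<noteq> 0" for k
  proof -
    have key: "key k \<le> key i" by (rule max[OF k])
    show "mi_len k \<le> mi_len i"
    proof (rule ccontr)
      assume "\<not> ?thesis"
      then have "Suc (mi_len i) * Suc p \<le> mi_len k * Suc p"
        by (intro mult_le_mono) auto
      moreover have "i a < Suc p"
        using le[of i] i(1) by (auto simp: qt_indices_iff)
      ultimately show False
        using key unfolding key_def by simp
    qed
    show "mi_len k = mi_len i \<Longrightarrow> k a \<le> i a"
      using key unfolding key_def by simp
  qed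
  let ?m = "i(a := i a + 2)"
  define v where "v = (\<lambda>x. if x \<in> T then mono_at xT ?m x else 0)"
  have "mi_len ?m = mi_len i + 2"
    using mi_len_upd_Suc[of "i(a := i a + 1)" a] mi_len_upd_Suc[of i a] by simp
  then have "v \<in> poly_space p T"
    using i(1) unfolding v_def qt_indices_iff by (intro restrict_mono_at_in_poly_space) simp
  with c have "0 = (\<Sum>k\<in>qt_indices p. c k * mi_deriv k (diff_op K \<beta> \<sigma> v) xT)"
    by simp
  also have "\<dots> = (\<Sum>k\<in>qt_indices p. if k = i
      then c i * - (K xT $ a $ a * (\<Prod>j\<in>UNIV. fact (?m j))) else 0)"
  proof (rule sum.cong[OF refl])
    fix k :: "'n \<Rightarrow> nat" assume k: "k \<in> qt_indices p"
    have "mi_deriv k (diff_op K \<beta> \<sigma> v) xT = mi_deriv k (diff_op K \<beta> \<sigma> (mono_at xT ?m)) xT"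
      unfolding mi_deriv_eq_partials
      by (rule partials_cong[OF qt_open diff_op_cong[OF qt_open] qt_mem]) (simp_all add: v_def)
    also have "c k * \<dots> = (if k = i then c i * - (K xT $ a $ a * (\<Prod>j\<in>UNIV. fact (?m j))) else 0)"
    proof (cases "c k = 0")
      case False
      have "mi_len k \<le> p - 2" using k by (simp add: qt_indices_iff)
      then show ?thesis
        using diff_coeffs.mi_deriv_diff_op_mono_at[OF qt_diff_coeffs qt_mem _ lex[OF k False]] by simp
    next
      case True
      with i(2) have "k \<noteq> i" by auto
      with True show ?thesis by (simp only: mult_zero_left if_False)
    qed
    finally show "c k * mi_deriv k (diff_op K \<beta> \<sigma> v) xT
        = (if k = i then c i * - (K xT $ a $ a * (\<Prod>j\<in>UNIV. fact (?m j))) else 0)" .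
  qed
  also have "\<dots> = c i * - (K xT $ a $ a * (\<Prod>j\<in>UNIV. fact (?m j)))"
    using i(1) by (simp only: sum.delta[OF finite_qt_indices] if_True)
  finally show False
    using i(2) qt_elliptic[of a] by (simp del: fun_upd_apply)
qed

lemma dim_poly_space_eq_dim_QT:
  "fun_space.dim (poly_space p T)
    = fun_space.dim (QT p T xT K \<beta> \<sigma>) + card (qt_indices p :: ('n \<Rightarrow> nat) set)"
proof -
  let ?S = "(\<lambda>i x. if x \<in> T then mono_at 0 i x else 0) ` {i. mi_len i \<le> p}"
  have "fun_space.subspace (poly_space p T)"
    unfolding poly_space_eq_span by (rule fun_space.subspace_span)
  moreover have "poly_space p T \<subseteq> fun_space.span ?S"
    unfolding poly_space_eq_span by (rule subset_refl)
  moreover have "finite ?S"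
    using finite_mi_len_le by (rule finite_imageI)
  ultimately show ?thesis
    unfolding QT_def
    by (rule dim_common_kernel[OF _ _ _ finite_qt_indices linear_on_qt_functional lin_indep_qt_functionals])
qed

end

subsection \<open>The dimension formula\<close>

lemma binom_int: "binom (int n) k = int (n choose k)"
  by (simp add: binom_def)

text \<open>Pascal's rule applied twice.\<close>

lemma binom_diff_eq_N_dim:
  assumes "d \<ge> 1"
  shows "binom (int p + int d) d - binom (int p + int d - 2) d = N_dim d p"
proof -
  obtain e where d: "d = Suc e" using assms by (cases d) auto
  show ?thesis
  proof (cases "p + e")
    \<comment> \<open>Here \<open>p = 0\<close> and \<open>d = 1\<close>: the terms with upper entry
      \<open>-1\<close> are 0 and both sides equal 1.\<close>
    case 0
    then show ?thesis by (simp add: d N_dim_def binom_def)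
  next
    case (Suc q)
    have "int p + int d = int (Suc (Suc q))" "int p + int d - 1 = int (Suc q)"
      "int p + int d - 2 = int q"
      using Suc d by simp_all
    then show ?thesis
      unfolding N_dim_def by (simp only: binom_int d) simp
  qed
qed

text \<open>Over the denominator \<open>(d - 1)! p!\<close> the two numerators are
  \<open>(p + d - 1) (p + d - 2)!\<close> and \<open>p (p + d - 2)!\<close>. The bound
  \<open>p + d \<ge> 2\<close> keeps the subtraction from being truncated.\<close>

lemma N_dim_eq_fact:
  assumes "d \<ge> 1" "p + d \<ge> 2"
  shows "real_of_int (N_dim d p)
    = fact (p + d - 2) * (2 * real p + real d - 1) / (fact (d - 1) * fact p)"
proof -
  obtain e where d: "d = Suc e" using assms by (cases d) auto
  obtain q where q: "p + e = Suc q" using assms(2) d by (cases "p + e") auto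
  have "int p + int d - 1 = int (Suc q)" "int p + int d - 2 = int q"
    using q d by simp_all
  then have "real_of_int (N_dim d p) = real (Suc q choose e) + real (q choose e)"
    unfolding N_dim_def by (simp only: binom_int d) simp
  also have "real (Suc q choose e) = real (p + e) * fact q / (fact e * fact p)"
  proof -
    have "real (Suc q choose e) = fact (Suc q) / (fact e * fact (Suc q - e))"
      using q by (intro binomial_fact) simp
    moreover have "Suc q - e = p" using q by simp
    ultimately show ?thesis by (simp only: fact_Suc q)
  qed
  also have "real (q choose e) = real p * fact q / (fact e * fact p)"
  proof (cases p)
    \<comment> \<open>For \<open>p = 0\<close> the lower entry \<open>e\<close> exceeds
      \<open>q\<close>, so the coefficient vanishes together with the factor
      \<open>p\<close>.\<close>
    case 0
    with q show ?thesis by simp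
  next
    case (Suc r)
    then have "q = r + e" using q by simp
    then have "real (q choose e) = fact q / (fact e * fact r)"
      using binomial_fact[of e q, where 'a = real] by simp
    then show ?thesis using Suc by (simp del: of_nat_Suc)
  qed
  finally show ?thesis
    using q d by (simp add: add_divide_distrib[symmetric] distrib_right[symmetric] algebra_simps)
qed

text \<open>For \<open>p = 0\<close> the second coefficient has upper entry \<open>-1\<close>, and
  the value is 1.\<close>

lemma N_dim_1: "p \<ge> 1 \<Longrightarrow> N_dim 1 p = 2"
  by (simp add: N_dim_def binom_def)

lemma N_dim_2: "N_dim 2 p = 2 * int p + 1"
  by (simp add: N_dim_def binom_def nat_add_distrib)

lemma N_dim_3: "N_dim 3 p = (int p + 1)\<^sup>2"
proof -
  have "real_of_int (N_dim 3 p)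
      = fact (p + 3 - 2) * (2 * real p + real 3 - 1) / (fact (3 - 1) * fact p)"
    by (rule N_dim_eq_fact) auto
  also have "\<dots> = fact (Suc p) * (2 * real p + 2) / (2 * fact p)"
    by simp
  also have "\<dots> = real_of_int ((int p + 1)\<^sup>2)"
    unfolding fact_Suc by (simp add: field_simps power2_eq_square)
  finally show ?thesis by (simp only: of_int_eq_iff)
qed

section \<open>Growth as the degree tends to infinity\<close>

lemma choose_add_bigo: "(\<lambda>p. real ((p + k) choose k)) \<in> O(\<lambda>p. real p ^ k)"
proof (rule bigoI)
  have "norm (real ((p + k) choose k)) \<le> (real (Suc k)) ^ k * norm (real p ^ k)" if p: "p \<ge> 1" for p
  proof -
    have "(p + k) choose k \<le> (p + k) ^ k"
      by (rule binomial_le_pow) simp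
    \<comment> \<open>For \<open>p \<ge> 1\<close> one has \<open>p + k \<le> (k + 1) * p\<close>,
      whence the constant \<open>(k + 1) ^ k\<close>.\<close>
    also have "\<dots> \<le> (Suc k * p) ^ k"
      using p by (intro power_mono) auto
    finally have "real ((p + k) choose k) \<le> real ((Suc k * p) ^ k)"
      by (simp only: of_nat_le_iff)
    then show ?thesis
      by (simp only: of_nat_power of_nat_mult power_mult_distrib) simp
  qed
  then show "eventually (\<lambda>p. norm (real ((p + k) choose k)) \<le> (real (Suc k)) ^ k * norm (real p ^ k)) sequentially"
    unfolding eventually_sequentially by blast
qed

text \<open>Both coefficients are at most \<open>(p + d - 1) choose (d - 1)\<close>, which gives the
  constant 2.\<close>

lemma N_dim_bigo:
  assumes "d \<ge> 1"
  shows "(\<lambda>p. real_of_int (N_dim d p)) \<in> O(\<lambda>p. real p ^ (d - 1))"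
proof -
  obtain e where d: "d = Suc e" using assms by (cases d) auto
  have "norm (real_of_int (N_dim d p)) \<le> 2 * norm (real ((p + e) choose e))" for p
  proof -
    have "0 \<le> binom (int p + int d - 2) e"
      by (simp add: binom_def)
    moreover have "binom (int p + int d - 2) e \<le> int ((p + e) choose e)"
    proof (cases "p + e")
      case (Suc q)
      then have "int p + int d - 2 = int q" using d by simp
      moreover have "q choose e \<le> Suc q choose e"
        by (cases e) auto
      ultimately show ?thesis
        unfolding Suc by (simp only: binom_int of_nat_le_iff)
    qed (simp add: d binom_def)
    moreover have "binom (int p + int d - 1) e = int ((p + e) choose e)"
      using binom_int[of "p + e"] by (simp add: d)
    ultimately show ?thesis
      unfolding N_dim_def by (simp add: d)
  qed
  then have "(\<lambda>p. real_of_int (N_dim d p)) \<in> O(\<lambda>p. real ((p + e) choose e))"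
    by (intro bigoI[of _ 2] always_eventually) blast
  also have "(\<lambda>p. real ((p + e) choose e)) \<in> O(\<lambda>p. real p ^ (d - 1))"
    using choose_add_bigo[of e] by (simp add: d)
  finally show ?thesis .
qed

text \<open>For \<open>d = 1\<close>, \<open>p = 0\<close> the space consists of the constants and
  has dimension 1, so the value 2 is claimed from \<open>p = 1\<close> on and the factorial formula
  for \<open>p + d \<ge> 2\<close>. In the growth statement the element, the point and the
  coefficients may vary with \<open>p\<close>.\<close>

theorem mainTheorem4:
  fixes d :: nat
  assumes d: "d = CARD('n::finite)"
  shows
    "(\<forall>(p::nat) (T :: (real^'n) set) xT K \<beta> \<sigma>. qt_setting p T xT K \<beta> \<sigma> \<longrightarrow>
        lin_indep_functionals (poly_space p T) (qt_indices p)
          (\<lambda>i v. mi_deriv i (diff_op K \<beta> \<sigma> v) xT)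
      \<and> int (fun_space.dim (poly_space p T)) - int (card (qt_indices p :: ('n \<Rightarrow> nat) set))
          = binom (int p + int d) d - binom (int p + int d - 2) d
      \<and> binom (int p + int d) d - binom (int p + int d - 2) d = N_dim d p
      \<and> N_dim d p = int (fun_space.dim (QT p T xT K \<beta> \<sigma>))
      \<and> (p + d \<ge> 2 \<longrightarrow>
           real_of_int (N_dim d p)
             = fact (p + d - 2) * (2 * real p + real d - 1) / (fact (d - 1) * fact p))
      \<and> (d = 1 \<and> p \<ge> 1 \<longrightarrow> fun_space.dim (QT p T xT K \<beta> \<sigma>) = 2)
      \<and> (d = 2 \<longrightarrow> fun_space.dim (QT p T xT K \<beta> \<sigma>) = 2 * p + 1)
      \<and> (d = 3 \<longrightarrow> fun_space.dim (QT p T xT K \<beta> \<sigma>) = (p + 1)\<^sup>2)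
      \<and> int (fun_space.dim (poly_space p T)) = binom (int p + int d) d)
   \<and> (\<forall>(T :: nat \<Rightarrow> (real^'n) set) xT K \<beta> \<sigma>.
        (\<forall>p. qt_setting p (T p) (xT p) (K p) (\<beta> p) (\<sigma> p)) \<longrightarrow>
          (\<lambda>p. real (fun_space.dim (QT p (T p) (xT p) (K p) (\<beta> p) (\<sigma> p))))
             \<in> O(\<lambda>p. real p ^ (d - 1))
        \<and> (\<lambda>p. real (fun_space.dim (poly_space p (T p)))) \<in> O(\<lambda>p. real p ^ d))"
proof -
  have d1: "d \<ge> 1" using d by (simp add: Suc_leI)
  have dimP: "int (fun_space.dim (poly_space p T)) = binom (int p + int d) d"
    if "qt_setting p (T :: (real^'n) set) xT K \<beta> \<sigma>" for p T xT K \<beta> \<sigma>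
    using dim_poly_space[OF qt_open[OF that] qt_mem[OF that], of p] binom_int[of "p + d" d]
    by (simp add: d)
  have dimQT: "N_dim d p = int (fun_space.dim (QT p T xT K \<beta> \<sigma>))"
    if "qt_setting p (T :: (real^'n) set) xT K \<beta> \<sigma>" for p T xT K \<beta> \<sigma>
    using dim_poly_space_eq_dim_QT[OF that] dimP[OF that] card_qt_indices[of p, where 'n = 'n]
      binom_diff_eq_N_dim[OF d1, of p] by (simp add: d)
  have dimcard: "int (fun_space.dim (poly_space p T)) - int (card (qt_indices p :: ('n \<Rightarrow> nat) set))
      = binom (int p + int d) d - binom (int p + int d - 2) d"
    if "qt_setting p (T :: (real^'n) set) xT K \<beta> \<sigma>" for p T xT K \<beta> \<sigma>
    using dimP[OF that] card_qt_indices[of p, where 'n = 'n] by (simp add: d)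
  have low: "d = 1 \<and> p \<ge> 1 \<Longrightarrow> fun_space.dim (QT p T xT K \<beta> \<sigma>) = 2"
      "d = 2 \<Longrightarrow> fun_space.dim (QT p T xT K \<beta> \<sigma>) = 2 * p + 1"
      "d = 3 \<Longrightarrow> fun_space.dim (QT p T xT K \<beta> \<sigma>) = (p + 1)\<^sup>2"
    if "qt_setting p (T :: (real^'n) set) xT K \<beta> \<sigma>" for p T xT K \<beta> \<sigma>
  proof -
    have "fun_space.dim (QT p T xT K \<beta> \<sigma>) = nat (N_dim d p)"
      using dimQT[OF that] by simp
    moreover have "nat ((int p + 1)\<^sup>2) = (p + 1)\<^sup>2"
      using nat_int[of "(p + 1)\<^sup>2"] by (simp add: add.commute)
    ultimately show "d = 1 \<and> p \<ge> 1 \<Longrightarrow> fun_space.dim (QT p T xT K \<beta> \<sigma>) = 2"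
      "d = 2 \<Longrightarrow> fun_space.dim (QT p T xT K \<beta> \<sigma>) = 2 * p + 1"
      "d = 3 \<Longrightarrow> fun_space.dim (QT p T xT K \<beta> \<sigma>) = (p + 1)\<^sup>2"
      using N_dim_1[of p] N_dim_2[of p] N_dim_3[of p] by auto
  qed
  show ?thesis
  proof (intro conjI allI impI)
    fix T :: "nat \<Rightarrow> (real^'n) set" and xT K \<beta> \<sigma>
    assume qt: "\<forall>p. qt_setting p (T p) (xT p) (K p) (\<beta> p) (\<sigma> p)"
    have "real (fun_space.dim (QT p (T p) (xT p) (K p) (\<beta> p) (\<sigma> p))) = real_of_int (N_dim d p)" for p
      using dimQT[OF qt[rule_format, of p]] by simp
    then show "(\<lambda>p. real (fun_space.dim (QT p (T p) (xT p) (K p) (\<beta> p) (\<sigma> p))))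
        \<in> O(\<lambda>p. real p ^ (d - 1))"
      using N_dim_bigo[OF d1] by simp
    have "fun_space.dim (poly_space p (T p)) = (p + d) choose d" for p
      using dimP[OF qt[rule_format, of p]] binom_int[of "p + d" d] by simp
    then show "(\<lambda>p. real (fun_space.dim (poly_space p (T p)))) \<in> O(\<lambda>p. real p ^ d)"
      using choose_add_bigo[of d] by simp
  qed (rule lin_indep_qt_functionals dimcard binom_diff_eq_N_dim[OF d1] dimQT N_dim_eq_fact[OF d1]
      low dimP; assumption)+
qed

end
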